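(* Let $CP_3(n)$ be defined by $\sum_{n\ge 0} CP_3(n)q^n = \dfrac{f_3^6f_6^6}{f_1^2f_2^2}$. Then \begin{align*} \sum_{n=0}^\infty CP_3(6n+1)q^n &= 2\frac{f_2^6f_3^{12}}{f_1^8f_6^6}+32q\frac{f_2^7f_3^3f_6^3}{f_1^5},\\ \sum_{n=0}^\infty CP_3(6n+3)q^n &= 8\frac{f_2^9f_3^9}{f_1^7f_6^3}+32q\frac{f_2^6f_6^6}{f_1^4},\\ \sum_{n=0}^\infty CP_3(6n+5)q^n &= 24\frac{f_2^8f_3^6}{f_1^6}. \end{align*}
   Context: For $|q|<1$ and integer $m\ge 1$, $f_m := (q^m;q^m)_\infty=\prod_{n\ge1}(1-q^{mn})$. $CP_3(n)$ is the number of $3$-core cubic bipartitions of $n$, defined by the generating function $\sum_{n\ge0}CP_3(n)q^n = \frac{f_3^6f_6^6}{f_1^2f_2^2}$. Identities are of formal power series in $q$.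
   Formalization: In the identity for CP_3(6n+1) the exponent of f_2 in the first term is corrected from 6 to 10, i.e. 2 f_2^10 f_3^12/(f_1^8 f_6^6); as printed it is false, since the coefficient of q^2 would be 236 while CP_3(13)=228. *)

theory Defs
  imports "HOL-Analysis.Analysis" "HOL-Computational_Algebra.Formal_Power_Series"
begin

text \<open>
  The infinite product is taken in the topology of \<^typ>\<open>rat fps\<close>. Since \<^const>\<open>prodinf\<close>
  starts at index 0, the factor with index \<open>n\<close> is the one usually indexed by \<open>n + 1\<close>.
  Below the product is shown to converge for every \<open>m \<ge> 1\<close>, with constant coefficient 1,
  so that quotients of such products are genuine ones.
\<close>

definition euler_f :: "nat \<Rightarrow> rat fps" where
  "euler_f m = prodinf (\<lambda>n. 1 - fps_X ^ (m * (n + 1)))"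

definition CP3 :: "nat \<Rightarrow> rat" where
  "CP3 n = fps_nth (euler_f 3 ^ 6 * euler_f 6 ^ 6 / (euler_f 1 ^ 2 * euler_f 2 ^ 2)) n"

lemma euler_f_partial_nth:
  fixes m k n :: nat
  assumes "m \<ge> 1" "k \<le> n"
  shows "fps_nth (\<Prod>i\<le>n. 1 - fps_X ^ (m * (i + 1)) :: rat fps) k =
         fps_nth (\<Prod>i\<le>k. 1 - fps_X ^ (m * (i + 1))) k"
  using assms(2)
proof (induction n rule: dec_induct)
  case base
  show ?case by simp
next
  case (step n)
  have "k < 1 * (Suc n + 1)" using step(1) by simp
  also have "\<dots> \<le> m * (Suc n + 1)" using assms(1) by (rule mult_le_mono1)
  finally have "k < m * (Suc n + 1)" .
  then have "fps_nth (p * (1 - fps_X ^ (m * (Suc n + 1)))) k = fps_nth p k" for p :: "rat fps"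
    unfolding right_diff_distrib fps_sub_nth fps_X_power_mult_right_nth by simp
  then show ?case using step.IH by (simp only: prod.atMost_Suc)
qed

lemma euler_f_has_prod:
  assumes "m \<ge> 1"
  shows "(\<lambda>n. 1 - fps_X ^ (m * (n + 1))) has_prod euler_f m"
    and "fps_nth (euler_f m) 0 = 1"
proof -
  let ?g = "\<lambda>n. 1 - fps_X ^ (m * (n + 1)) :: rat fps"
  define p where "p = Abs_fps (\<lambda>k. fps_nth (\<Prod>i\<le>k. ?g i) k)"
  have lim: "(\<lambda>n. \<Prod>i\<le>n. ?g i) \<longlonglongrightarrow> p"
  proof (rule tendsto_fpsI)
    fix k
    show "\<forall>\<^sub>F n in sequentially. fps_nth (\<Prod>i\<le>n. ?g i) k = fps_nth p k"
      using eventually_ge_at_top[of k]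
      unfolding p_def fps_nth_Abs_fps by eventually_elim (rule euler_f_partial_nth[OF assms])
  qed
  have p0: "fps_nth p 0 = 1" using assms by (simp add: p_def)
  then have "p \<noteq> 0" by auto
  with lim have "?g has_prod p" by (simp add: has_prod_def raw_has_prod_def)
  moreover from this have "euler_f m = p"
    unfolding euler_f_def by (metis has_prod_unique)
  ultimately show "?g has_prod euler_f m" "fps_nth (euler_f m) 0 = 1" using p0 by simp_all
qed

end

theory Submission
  imports Defs "HOL-Computational_Algebra.Formal_Laurent_Series"
begin

text \<open>
  Write \<open>\<phi>(-q) = f\<^sub>1\<^sup>2 / f\<^sub>2\<close>. The 2-dissection
  \<open>f\<^sub>3\<^sup>3 / f\<^sub>1 = f\<^sub>4\<^sup>3 f\<^sub>6\<^sup>2 / (f\<^sub>2\<^sup>2 f\<^sub>1\<^sub>2) + q f\<^sub>1\<^sub>2\<^sup>3 / f\<^sub>4\<close>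
  gives, after squaring, \<open>2 f\<^sub>2\<^sup>2 f\<^sub>3\<^sup>8 f\<^sub>6\<^sup>2 / f\<^sub>1\<^sup>4 = 2 f\<^sub>3\<^sup>8 f\<^sub>6\<^sup>2 / \<phi>(-q)\<^sup>2\<close>
  as the generating function of \<open>CP\<^sub>3(2n+1)\<close>; squaring the 3-dissection of \<open>1 / \<phi>(-q)\<close> then gives all three claims.

  By the Jacobi triple product, the 2-dissection amounts to splitting the double series
  \<open>\<Sum> (-1)\<^sup>m q^(3m\<^sup>2 + 3n\<^sup>2 + 2n)\<close> according to the parity of \<open>m + n\<close>. Splitting \<open>\<phi>(-q)\<close> by
  the residue of the summation index mod 3 gives \<open>\<phi>(-q) = a - 2qb\<close> with \<open>a\<close>, \<open>b\<close> series in \<open>q\<^sup>3\<close>; its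
  inverse is \<open>(a\<^sup>2 + 2qab + 4q\<^sup>2b\<^sup>2) / (a\<^sup>3 - 8q\<^sup>3b\<^sup>3)\<close>, and the denominator is the norm
  \<open>\<phi>(-q) \<phi>(-\<omega>q) \<phi>(-\<omega>\<^sup>2q)\<close>, computed factor by factor from the product.
\<close>

subsection \<open>Truncated power series and Euler products\<close>

text \<open>Congruence modulo q^n. An identity between infinite products and theta series is proved
  by comparing finite truncations modulo q^n for every n, so that limits enter only in
  \<open>euler_f_cong\<close>.\<close>

definition fps_cong :: "nat \<Rightarrow> 'a fps \<Rightarrow> 'a fps \<Rightarrow> bool" where
  "fps_cong n A B \<longleftrightarrow> (\<forall>k<n. fps_nth A k = fps_nth B k)"

lemma fps_cong_refl [simp]: "fps_cong n A A"
  by (simp add: fps_cong_def)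

lemma fps_cong_sym: "fps_cong n A B \<Longrightarrow> fps_cong n B A"
  by (simp add: fps_cong_def)

lemma fps_cong_trans [trans]: "fps_cong n A B \<Longrightarrow> fps_cong n B C \<Longrightarrow> fps_cong n A C"
  by (simp add: fps_cong_def)

lemma fps_cong_mono: "fps_cong n A B \<Longrightarrow> m \<le> n \<Longrightarrow> fps_cong m A B"
  by (simp add: fps_cong_def)

lemma fps_cong_add:
  "fps_cong n A B \<Longrightarrow> fps_cong n C D \<Longrightarrow> fps_cong n (A + C) (B + D :: 'a::comm_ring_1 fps)"
  by (simp add: fps_cong_def)

lemma fps_cong_diff:
  "fps_cong n A B \<Longrightarrow> fps_cong n C D \<Longrightarrow> fps_cong n (A - C) (B - D :: 'a::comm_ring_1 fps)"
  by (simp add: fps_cong_def)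

lemma fps_cong_mult:
  fixes A B C D :: "'a::comm_ring_1 fps"
  assumes "fps_cong n A B" "fps_cong n C D"
  shows "fps_cong n (A * C) (B * D)"
  using assms by (auto simp: fps_cong_def fps_mult_nth intro!: sum.cong)

lemma fps_cong_power:
  fixes A B :: "'a::comm_ring_1 fps"
  shows "fps_cong n A B \<Longrightarrow> fps_cong n (A ^ k) (B ^ k)"
  by (induction k) (auto intro: fps_cong_mult)

lemma fps_cong_sum:
  fixes F G :: "'i \<Rightarrow> 'a::comm_ring_1 fps"
  assumes "\<And>i. i \<in> I \<Longrightarrow> fps_cong n (F i) (G i)"
  shows "fps_cong n (sum F I) (sum G I)"
  using assms by (auto simp: fps_cong_def fps_sum_nth intro!: sum.cong)

text \<open>A monomial factor raises the precision. In the triple product this compensates for the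
  low precision of the outer q-binomial coefficients.\<close>

lemma fps_cong_X_power_mult:
  fixes A B :: "'a::comm_ring_1 fps"
  assumes "fps_cong n A B"
  shows "fps_cong (m + n) (fps_X ^ m * A) (fps_X ^ m * B)"
  using assms by (auto simp: fps_cong_def fps_X_power_mult_nth)

lemma fps_cong_eqI:
  assumes "\<And>n. fps_cong n A B"
  shows "A = B"
  using assms[of "Suc _"] by (auto simp: fps_cong_def fps_eq_iff)

text \<open>The finite q-Pochhammer symbol (Q;Q)_n. The base is any ring element, so that powers of
  \<open>fps_X\<close> can be put in for it.\<close>

definition q_poch :: "'a::comm_ring_1 \<Rightarrow> nat \<Rightarrow> 'a" where
  "q_poch Q n = (\<Prod>i<n. 1 - Q ^ Suc i)"

lemma q_poch_0 [simp]: "q_poch Q 0 = 1"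
  by (simp add: q_poch_def)

lemma q_poch_Suc: "q_poch Q (Suc n) = q_poch Q n * (1 - Q ^ Suc n)"
  by (simp add: q_poch_def)

text \<open>Every factor after the first k is 1 modulo q^(m(k+1)).\<close>

lemma q_poch_cong:
  fixes m :: nat
  assumes "m \<ge> 1" "k \<le> n"
  shows "fps_cong (m * Suc k) (q_poch (fps_X ^ m :: 'a::comm_ring_1 fps) n) (q_poch (fps_X ^ m) k)"
  using assms(2)
proof (induction n rule: dec_induct)
  case base
  show ?case by simp
next
  case (step n)
  have "m * Suc k \<le> m * Suc n" using step by simp
  then have "fps_cong (m * Suc k) (1 - (fps_X ^ m) ^ Suc n) (1 :: 'a fps)"
    unfolding power_mult[symmetric] by (auto simp: fps_cong_def)
  from fps_cong_mult[OF step.IH this] show ?case by (simp add: q_poch_Suc)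
qed

lemma q_poch_nth_0:
  assumes "m \<ge> 1"
  shows "fps_nth (q_poch (fps_X ^ m :: 'a::comm_ring_1 fps) n) 0 = 1"
  using q_poch_cong[OF assms, of 0 n, where 'a='a] assms by (simp add: fps_cong_def)

text \<open>Convergence of formal power series means that each coefficient is eventually constant;
  its final value is read off from a long partial product, which \<open>q_poch_cong\<close> compares
  with the short one.\<close>

lemma euler_f_cong:
  assumes "m \<ge> 1"
  shows "fps_cong (m * Suc n) (euler_f m) (q_poch (fps_X ^ m) n)"
proof -
  have lim: "(\<lambda>n. \<Prod>i\<le>n. 1 - fps_X ^ (m * (i + 1)) :: rat fps) \<longlonglongrightarrow> euler_f m"
    using euler_f_has_prod[OF assms] by (auto simp: has_prod_def raw_has_prod_def)
  show ?thesis
    unfolding fps_cong_def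
  proof (intro allI impI)
    fix k assume k: "k < m * Suc n"
    have "\<forall>\<^sub>F N in sequentially. fps_nth (\<Prod>i\<le>N. 1 - fps_X ^ (m * (i + 1)) :: rat fps) k = fps_nth (euler_f m) k"
      using lim by (auto simp: tendsto_fps_iff)
    moreover have "\<forall>\<^sub>F N in sequentially. n \<le> N"
      by (rule eventually_ge_at_top)
    ultimately have "\<forall>\<^sub>F N in sequentially. fps_nth (euler_f m) k = fps_nth (q_poch (fps_X ^ m) n) k"
    proof eventually_elim
      case (elim N)
      \<comment> \<open>The product over i from 0 to N has N + 1 factors, hence
        \<open>Suc N\<close>.\<close>
      have "(\<Prod>i\<le>N. 1 - fps_X ^ (m * (i + 1)) :: rat fps) = q_poch (fps_X ^ m) (Suc N)"
        unfolding q_poch_def lessThan_Suc_atMost power_mult[symmetric] by simp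
      then show ?case using elim k q_poch_cong[OF assms, of n "Suc N", where 'a=rat]
        by (simp add: fps_cong_def)
    qed
    then show "fps_nth (euler_f m) k = fps_nth (q_poch (fps_X ^ m) n) k" by simp
  qed
qed

text \<open>The cruder precision n is uniform in m and N, so the products of one identity can be cut
  at different lengths such as 2n, 3n or 6n.\<close>

lemma euler_f_cong_ge:
  assumes "m \<ge> 1" "n \<le> N"
  shows "fps_cong n (euler_f m) (q_poch (fps_X ^ m) N)"
proof (rule fps_cong_mono[OF euler_f_cong[OF assms(1)]])
  have "1 * Suc N \<le> m * Suc N" using assms(1) by (rule mult_le_mono1)
  then show "n \<le> m * Suc N" using assms(2) by simp
qed

subsection \<open>The Jacobi triple product\<close>

text \<open>Gaussian binomials by a q-Pascal rule, which avoids division and makes sense in every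
  commutative ring. Of the two such rules, this one matches splitting off the last factor u + v Q^n
  in the q-binomial theorem.\<close>

fun q_binom :: "'a::comm_ring_1 \<Rightarrow> nat \<Rightarrow> nat \<Rightarrow> 'a" where
  "q_binom Q n 0 = 1"
| "q_binom Q 0 (Suc k) = 0"
| "q_binom Q (Suc n) (Suc k) = q_binom Q n (Suc k) + Q ^ (n - k) * q_binom Q n k"

lemma q_binom_eq_0: "n < k \<Longrightarrow> q_binom Q n k = 0"
  by (induction Q n k rule: q_binom.induct) auto

text \<open>The quotient formula for Gaussian binomials, cleared of denominators.\<close>

lemma q_binom_q_poch:
  "k \<le> n \<Longrightarrow> q_binom Q n k * q_poch Q k * q_poch Q (n - k) = q_poch Q n"
proof (induction Q n k rule: q_binom.induct)
  case (3 Q n k)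
  show ?case
  proof (cases "k = n")
    case True
    then show ?thesis using 3(2) by (simp add: q_binom_eq_0 q_poch_Suc flip: mult.assoc)
  next
    case False
    then have le: "Suc k \<le> n" using 3(3) by simp
    define d where "d = n - Suc k"
    have n: "n = Suc (k + d)" using le by (simp add: d_def)
    have I1: "q_binom Q n (Suc k) * q_poch Q (Suc k) * q_poch Q d = q_poch Q n"
      and I2: "q_binom Q n k * q_poch Q k * q_poch Q (Suc d) = q_poch Q n"
      using 3 le by (simp_all add: n)
    have "q_binom Q (Suc n) (Suc k) * q_poch Q (Suc k) * q_poch Q (Suc n - Suc k)
      = (q_binom Q n (Suc k) + Q ^ Suc d * q_binom Q n k) * q_poch Q (Suc k) * q_poch Q (Suc d)"
      by (simp add: n)
    \<comment> \<open>With n = k + d + 1 the two weights add up to 1 - Q^(n+1), the new factor of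
      \<open>q_poch Q (Suc n)\<close>.\<close>
    also have "\<dots> = (1 - Q ^ Suc d) * (q_binom Q n (Suc k) * q_poch Q (Suc k) * q_poch Q d)
       + Q ^ Suc d * (1 - Q ^ Suc k) * (q_binom Q n k * q_poch Q k * q_poch Q (Suc d))"
      unfolding q_poch_Suc by (simp add: algebra_simps)
    also have "\<dots> = q_poch Q n * (1 - Q ^ Suc n)"
      unfolding I1 I2 by (simp add: n algebra_simps power_add)
    finally show ?thesis by (simp add: q_poch_Suc)
  qed
qed auto

text \<open>The homogeneous form in u and v allows u to be a power of q later, which keeps negative
  exponents out of the triple product.\<close>

lemma q_binomial_theorem:
  fixes u v Q :: "'a::comm_ring_1"
  shows "(\<Prod>i<n. u + v * Q ^ i) = (\<Sum>k\<le>n. q_binom Q n k * Q ^ (k choose 2) * v ^ k * u ^ (n - k))"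
proof (induction n)
  case (Suc n)
  let ?t = "\<lambda>k. q_binom Q n k * Q ^ (k choose 2) * v ^ k"
  have ch: "Suc k choose 2 = (k choose 2) + k" for k
    by (simp add: numeral_2_eq_2)
  have "(\<Sum>k\<le>Suc n. q_binom Q (Suc n) k * Q ^ (k choose 2) * v ^ k * u ^ (Suc n - k))
    = u ^ Suc n + (\<Sum>k\<le>n. (q_binom Q n (Suc k) + Q ^ (n - k) * q_binom Q n k) * Q ^ (Suc k choose 2) * v ^ Suc k * u ^ (n - k))"
    by (subst sum.atMost_Suc_shift) (simp add: binomial_eq_0)
  also have "\<dots> = u ^ Suc n + (\<Sum>k\<le>n. ?t (Suc k) * u ^ (n - k)) + (\<Sum>k\<le>n. v * Q ^ n * (?t k * u ^ (n - k)))"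
  proof -
    have "(q_binom Q n (Suc k) + Q ^ (n - k) * q_binom Q n k) * Q ^ (Suc k choose 2) * v ^ Suc k * u ^ (n - k)
      = ?t (Suc k) * u ^ (n - k) + v * Q ^ n * (?t k * u ^ (n - k))" if "k \<le> n" for k
    proof -
      have "Q ^ n = Q ^ (n - k) * Q ^ k" using that by (simp flip: power_add)
      then show ?thesis unfolding ch by (simp add: algebra_simps power_add)
    qed
    then show ?thesis by (simp add: sum.distrib)
  qed
  also have "u ^ Suc n + (\<Sum>k\<le>n. ?t (Suc k) * u ^ (n - k)) = (\<Sum>k\<le>Suc n. ?t k * u ^ (Suc n - k))"
    by (subst sum.atMost_Suc_shift) (simp add: binomial_eq_0)
  also have "\<dots> = (\<Sum>k\<le>n. ?t k * u ^ (Suc n - k))"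
    by (simp add: q_binom_eq_0)
  also have "\<dots> = u * (\<Sum>k\<le>n. ?t k * u ^ (n - k))"
    unfolding sum_distrib_left by (intro sum.cong) (auto simp: Suc_diff_le algebra_simps)
  finally show ?case
    unfolding prod.lessThan_Suc Suc.IH sum_distrib_left[symmetric] by (simp add: algebra_simps)
qed (simp add: binomial_eq_0)

section \<open>Generating functions of weighted index sets, and theta series\<close>

definition weighted_gf :: "'i set \<Rightarrow> ('i \<Rightarrow> nat) \<Rightarrow> ('i \<Rightarrow> 'a) \<Rightarrow> 'a::comm_ring_1 fps" where
  "weighted_gf A e w = Abs_fps (\<lambda>k. \<Sum>x\<in>{x\<in>A. e x = k}. w x)"

text \<open>The fibre over k of the summed exponent is the disjoint union of products of fibres over
  i and k - i. Finite fibres matter because a sum over an infinite set is 0 by convention.\<close>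

lemma weighted_gf_mult:
  assumes "\<And>k. finite {x\<in>A. e x = k}" "\<And>k. finite {y\<in>B. e' y = k}"
  shows "weighted_gf A e w * weighted_gf B e' w' =
    weighted_gf (A \<times> B) (\<lambda>(x, y). e x + e' y) (\<lambda>(x, y). w x * w' y)"
proof (rule fps_ext)
  fix k
  have "fps_nth (weighted_gf A e w * weighted_gf B e' w') k
    = (\<Sum>i\<in>{0..k}. \<Sum>(x, y)\<in>{x\<in>A. e x = i} \<times> {y\<in>B. e' y = k - i}. w x * w' y)"
    by (simp add: fps_mult_nth weighted_gf_def sum_product sum.cartesian_product)
  also have "\<dots> = (\<Sum>(x, y)\<in>(\<Union>i\<in>{0..k}. {x\<in>A. e x = i} \<times> {y\<in>B. e' y = k - i}). w x * w' y)"
    by (rule sum.UNION_disjoint[symmetric]) (auto simp: assms)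
  also have "(\<Union>i\<in>{0..k}. {x\<in>A. e x = i} \<times> {y\<in>B. e' y = k - i})
    = {p\<in>A \<times> B. (case p of (x, y) \<Rightarrow> e x + e' y) = k}"
    by auto
  finally show "fps_nth (weighted_gf A e w * weighted_gf B e' w') k =
    fps_nth (weighted_gf (A \<times> B) (\<lambda>(x, y). e x + e' y) (\<lambda>(x, y). w x * w' y)) k"
    by (simp add: weighted_gf_def)
qed

lemma weighted_gf_reindex:
  assumes "bij_betw g A B" "\<And>x. x \<in> A \<Longrightarrow> e' (g x) = e x" "\<And>x. x \<in> A \<Longrightarrow> w' (g x) = w x"
  shows "weighted_gf B e' w' = weighted_gf A e w"
proof (rule fps_ext)
  fix k
  have "bij_betw g {x\<in>A. e x = k} {y\<in>B. e' y = k}"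
    using assms(1,2) by (auto simp: bij_betw_def inj_on_def)
  from sum.reindex_bij_betw[OF this, of w']
  have "(\<Sum>y\<in>{y\<in>B. e' y = k}. w' y) = (\<Sum>x\<in>{x\<in>A. e x = k}. w x)"
    by (simp add: assms(3))
  then show "fps_nth (weighted_gf B e' w') k = fps_nth (weighted_gf A e w) k"
    by (simp add: weighted_gf_def)
qed

lemma weighted_gf_Un:
  assumes "A \<inter> B = {}" "\<And>k. finite {x\<in>A. e x = k}" "\<And>k. finite {x\<in>B. e x = k}"
  shows "weighted_gf (A \<union> B) e w = weighted_gf A e w + weighted_gf B e w"
proof (rule fps_ext)
  fix k
  have "{x\<in>A \<union> B. e x = k} = {x\<in>A. e x = k} \<union> {x\<in>B. e x = k}" by auto
  with assms show "fps_nth (weighted_gf (A \<union> B) e w) k = fps_nth (weighted_gf A e w + weighted_gf B e w) k"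
    by (auto simp: weighted_gf_def intro!: sum.union_disjoint)
qed

lemma weighted_gf_shift: "weighted_gf A (\<lambda>x. c + e x) w = fps_X ^ c * weighted_gf A e w"
proof (rule fps_ext)
  fix k
  have "{x\<in>A. c + e x = k} = (if k < c then {} else {x\<in>A. e x = k - c})" by auto
  then show "fps_nth (weighted_gf A (\<lambda>x. c + e x) w) k = fps_nth (fps_X ^ c * weighted_gf A e w) k"
    by (simp add: weighted_gf_def fps_X_power_mult_nth)
qed

lemma weighted_gf_uminus: "weighted_gf A e (\<lambda>x. - w x) = - weighted_gf A e w"
  by (rule fps_ext) (simp add: weighted_gf_def sum_negf)

lemma weighted_gf_fps_cong:
  assumes "finite S" "S \<subseteq> A" "\<And>x. x \<in> A \<Longrightarrow> e x < n \<Longrightarrow> x \<in> S"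
  shows "fps_cong n (weighted_gf A e w) (\<Sum>x\<in>S. fps_const (w x) * fps_X ^ e x)"
  unfolding fps_cong_def
proof (intro allI impI)
  fix k assume "k < n"
  then have "{x\<in>A. e x = k} = {x\<in>S. e x = k}" using assms(2,3) by auto
  then show "fps_nth (weighted_gf A e w) k = fps_nth (\<Sum>x\<in>S. fps_const (w x) * fps_X ^ e x) k"
    using assms(1)
    by (simp add: weighted_gf_def fps_sum_nth sum.If_cases if_distrib Int_def conj_commute eq_commute cong: if_cong)
qed

text \<open>The series of eps^j q^(a j^2 + b j) over all integers j. It is meant for eps = 1 or -1,
  where eps^j depends only on the parity of j and the absolute value gives a natural
  exponent.\<close>

definition theta :: "'a \<Rightarrow> int \<Rightarrow> int \<Rightarrow> 'a::comm_ring_1 fps" where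
  "theta \<epsilon> a b = weighted_gf UNIV (\<lambda>j::int. nat (a * j ^ 2 + b * j)) (\<lambda>j. \<epsilon> ^ nat \<bar>j\<bar>)"

text \<open>This bound makes \<open>nat\<close> harmless in \<open>theta\<close>, makes the fibres
  finite, and shows that only indices with |j| < n matter modulo q^n.\<close>

lemma theta_exponent_ge:
  fixes a b j :: int
  assumes "\<bar>b\<bar> < a"
  shows "\<bar>j\<bar> \<le> a * j ^ 2 + b * j"
proof -
  have "\<bar>j\<bar> * 1 \<le> \<bar>j\<bar> * (a * \<bar>j\<bar> - \<bar>b\<bar>)"
  proof (cases "j = 0")
    case False
    then have "a * 1 \<le> a * \<bar>j\<bar>" using assms by (intro mult_left_mono) auto
    then show ?thesis using assms by (intro mult_left_mono) auto
  qed simp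
  also have "\<dots> = a * j ^ 2 - \<bar>b * j\<bar>"
    by (simp add: algebra_simps power2_eq_square abs_mult flip: abs_mult)
  finally show ?thesis by linarith
qed

lemma finite_theta_fibre:
  fixes a b :: int
  assumes "\<bar>b\<bar> < a"
  shows "finite {j. P j \<and> nat (a * j ^ 2 + b * j) = k}"
proof (rule finite_subset)
  show "{j. P j \<and> nat (a * j ^ 2 + b * j) = k} \<subseteq> {- int k..int k}"
  proof
    fix j assume "j \<in> {j. P j \<and> nat (a * j ^ 2 + b * j) = k}"
    then have "nat (a * j ^ 2 + b * j) = k" by simp
    then show "j \<in> {- int k..int k}"
      using theta_exponent_ge[OF assms, of j] unfolding atLeastAtMost_iff by linarith
  qed
qed simp

text \<open>The q-binomial theorem with 2n factors in base q^(2a), recentred at k = n: the lower and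
  upper halves of the factors yield the two families of the product, up to a common monomial that
  cancels.\<close>

lemma jacobi_triple_product_finite:
  fixes \<epsilon> :: "'a::idom" and a b :: int
  assumes ab: "\<bar>b\<bar> < a" and eps: "\<epsilon> ^ 2 = 1"
  shows "(\<Prod>i<n. (1 + fps_const \<epsilon> * fps_X ^ nat (a * (2 * int i + 1) + b)) *
                 (1 + fps_const \<epsilon> * fps_X ^ nat (a * (2 * int i + 1) - b))) =
         (\<Sum>k\<le>2 * n. q_binom (fps_X ^ nat (2 * a)) (2 * n) k * (fps_const (\<epsilon> ^ (k + n)) *
            fps_X ^ nat (a * (int k - int n) ^ 2 + b * (int k - int n))))"
    (is "?L = ?R")
proof (cases "n = 0")
  case False
  \<comment> \<open>The choice makes s - 2ai, for i = n-1 down to 0, run through a(2i'+1) - b, and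
    2ai - s, for i from n upwards, through a(2i'+1) + b, where i' counts from 0.\<close>
  define s where "s = nat (a * (2 * int n - 1) - b)"
  define A where "A = nat a"
  have a: "a = int A" using ab by (simp add: A_def)
  have "a * 1 \<le> a * (2 * int n - 1)" using ab False by (intro mult_left_mono) auto
  then have s: "int s = a * (2 * int n - 1) - b" using ab by (simp add: s_def)
  define v where "v = fps_const \<epsilon>"
  have v2: "v * v = 1" using eps by (simp add: v_def power2_eq_square)
  have vpow: "v ^ (n + k) * v ^ n = v ^ k" for k
  proof -
    have "v ^ (n + k) * v ^ n = (v * v) ^ n * v ^ k"
      by (simp only: power_add power_mult_distrib mult_ac)
    then show ?thesis by (simp add: v2)
  qed
  \<comment> \<open>The total exponent pulled out: \<open>A * n * (n - 1)\<close> from the lower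
    half and \<open>n * s\<close> from the upper half.\<close>
  define E where "E = A * n * (n - 1) + n * s"
  have tri: "(\<Prod>i<m. fps_X ^ (2 * A * i) :: 'a fps) = fps_X ^ (A * m * (m - 1))" for m
  proof (induction m)
    case (Suc m)
    show ?case unfolding prod.lessThan_Suc Suc power_add[symmetric]
      by (rule arg_cong[where f = "\<lambda>k. fps_X ^ k"]) (cases m; simp add: algebra_simps)
  qed simp
  \<comment> \<open>In the lower half q^s is the higher power, so v q^(2Ai) is pulled out; v stays
    inside the bracket because v is its own inverse. The index is reversed so that the exponents
    increase.\<close>
  have low: "(\<Prod>i<n. fps_X ^ s + v * fps_X ^ (2 * A * i)) =
    v ^ n * fps_X ^ (A * n * (n - 1)) * (\<Prod>i<n. 1 + v * fps_X ^ nat (a * (2 * int i + 1) - b))"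
  proof -
    have "(\<Prod>i<n. fps_X ^ s + v * fps_X ^ (2 * A * i))
      = (\<Prod>i<n. fps_X ^ s + v * fps_X ^ (2 * A * (n - Suc i)))"
      by (rule prod.nat_diff_reindex[symmetric])
    also have "\<dots> = (\<Prod>i<n. v * fps_X ^ (2 * A * (n - Suc i)) * (1 + v * fps_X ^ nat (a * (2 * int i + 1) - b)))"
    proof (rule prod.cong[OF refl])
      fix i assume "i \<in> {..<n}"
      then obtain d where d: "n = Suc (i + d)" by (auto dest: less_imp_Suc_add)
      have "a * 1 \<le> a * (2 * int i + 1)" using ab by (intro mult_left_mono) auto
      then have "int (nat (a * (2 * int i + 1) - b)) = a * (2 * int i + 1) - b"
        using ab by simp
      then have "int s = int (2 * A * (n - Suc i) + nat (a * (2 * int i + 1) - b))"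
        unfolding of_nat_add by (simp add: s a d algebra_simps)
      then have "s = 2 * A * (n - Suc i) + nat (a * (2 * int i + 1) - b)"
        by linarith
      then have "fps_X ^ s = v * v * (fps_X ^ (2 * A * (n - Suc i)) * fps_X ^ nat (a * (2 * int i + 1) - b))"
        by (simp only: v2 power_add mult_1_left)
      then show "fps_X ^ s + v * fps_X ^ (2 * A * (n - Suc i)) =
        v * fps_X ^ (2 * A * (n - Suc i)) * (1 + v * fps_X ^ nat (a * (2 * int i + 1) - b))"
        by (simp only:) (simp add: algebra_simps)
    qed
    also have "\<dots> = v ^ n * (\<Prod>i<n. fps_X ^ (2 * A * (n - Suc i))) * (\<Prod>i<n. 1 + v * fps_X ^ nat (a * (2 * int i + 1) - b))"
      by (simp add: prod.distrib)
    also have "(\<Prod>i<n. fps_X ^ (2 * A * (n - Suc i)) :: 'a fps) = (\<Prod>i<n. fps_X ^ (2 * A * i))"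
      by (rule prod.nat_diff_reindex)
    finally show ?thesis by (simp only: tri)
  qed
  have high: "(\<Prod>i\<in>{n..<2 * n}. fps_X ^ s + v * fps_X ^ (2 * A * i)) =
    fps_X ^ (n * s) * (\<Prod>i<n. 1 + v * fps_X ^ nat (a * (2 * int i + 1) + b))"
  proof -
    have "(\<Prod>i\<in>{n..<2 * n}. fps_X ^ s + v * fps_X ^ (2 * A * i))
      = (\<Prod>i<n. fps_X ^ s + v * fps_X ^ (2 * A * (i + n)))"
      using prod.shift_bounds_nat_ivl[of "\<lambda>i. fps_X ^ s + v * fps_X ^ (2 * A * i)" 0 n n]
      by (simp add: mult_2 lessThan_atLeast0)
    also have "\<dots> = (\<Prod>i<n. fps_X ^ s * (1 + v * fps_X ^ nat (a * (2 * int i + 1) + b)))"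
    proof (rule prod.cong[OF refl])
      fix i
      have "a * 1 \<le> a * (2 * int i + 1)" using ab by (intro mult_left_mono) auto
      then have "int (nat (a * (2 * int i + 1) + b)) = a * (2 * int i + 1) + b"
        using ab by simp
      then have "int (2 * A * (i + n)) = int (s + nat (a * (2 * int i + 1) + b))"
        unfolding of_nat_add by (simp add: s a algebra_simps)
      then have "2 * A * (i + n) = s + nat (a * (2 * int i + 1) + b)" by linarith
      then show "fps_X ^ s + v * fps_X ^ (2 * A * (i + n)) =
        fps_X ^ s * (1 + v * fps_X ^ nat (a * (2 * int i + 1) + b))"
        by (simp only: power_add) (simp add: algebra_simps)
    qed
    finally show ?thesis by (simp add: prod.distrib mult.commute flip: power_mult)
  qed
  have "v ^ n * fps_X ^ E * ?L = (\<Prod>i<n. fps_X ^ s + v * fps_X ^ (2 * A * i)) * (\<Prod>i\<in>{n..<2 * n}. fps_X ^ s + v * fps_X ^ (2 * A * i))"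
    unfolding low high E_def by (simp add: prod.distrib power_add v_def mult_ac)
  also have "\<dots> = (\<Prod>i<2 * n. fps_X ^ s + v * (fps_X ^ (2 * A)) ^ i)"
    unfolding lessThan_atLeast0 power_mult[symmetric]
    by (rule prod.atLeastLessThan_concat) auto
  also have "\<dots> = (\<Sum>k\<le>2 * n. q_binom (fps_X ^ (2 * A)) (2 * n) k * (fps_X ^ (2 * A)) ^ (k choose 2) * v ^ k * (fps_X ^ s) ^ (2 * n - k))"
    by (rule q_binomial_theorem)
  also have "\<dots> = (\<Sum>k\<le>2 * n. v ^ n * fps_X ^ E * (q_binom (fps_X ^ (2 * A)) (2 * n) k * (v ^ (k + n) *
            fps_X ^ nat (a * (int k - int n) ^ 2 + b * (int k - int n)))))"
  proof (rule sum.cong[OF refl])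
    fix k assume "k \<in> {..2 * n}"
    then have k: "k \<le> 2 * n" by simp
    define j where "j = int k - int n"
    have ik: "int k = int n + j" by (simp add: j_def)
    have ch: "2 * int (k choose 2) = int k * (int k - 1)"
    proof -
      have "2 * (k choose 2) = k * (k - 1)" by (cases k) (auto simp: choose_two)
      then have "2 * int (k choose 2) = int (k * (k - 1))" by linarith
      then show ?thesis by (cases k) (auto simp: algebra_simps)
    qed
    \<comment> \<open>With k = n + j, the terms linear in j collect to a(2n-1)j - sj = bj.\<close>
    have "int (2 * A * (k choose 2) + s * (2 * n - k)) = int (E + nat (a * j ^ 2 + b * j))"
    proof -
      have "int (2 * A * (k choose 2) + s * (2 * n - k)) = a * (2 * int (k choose 2)) + int s * (2 * int n - int k)"
        using k by (simp add: a of_nat_diff)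
      also have "\<dots> = a * (int n * (int n - 1)) + int n * int s + (a * j ^ 2 + b * j)"
        unfolding ch s ik by (simp add: algebra_simps power2_eq_square)
      also have "\<dots> = int (E + nat (a * j ^ 2 + b * j))"
      proof -
        have "int (n * (n - 1)) = int n * (int n - 1)" using False by (cases n) (auto simp: algebra_simps)
        then have "int E = a * (int n * (int n - 1)) + int n * int s"
          unfolding E_def of_nat_add mult.assoc of_nat_mult[of A] a by simp
        then show ?thesis using theta_exponent_ge[OF ab, of j] by simp
      qed
      finally show ?thesis .
    qed
    then have e: "2 * A * (k choose 2) + s * (2 * n - k) = E + nat (a * j ^ 2 + b * j)" by linarith
    have "(fps_X ^ (2 * A)) ^ (k choose 2) * v ^ k * (fps_X ^ s) ^ (2 * n - k) = v ^ k * fps_X ^ (2 * A * (k choose 2) + s * (2 * n - k))"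
      by (simp only: power_mult[symmetric] power_add mult_ac)
    also have "\<dots> = v ^ n * v ^ (k + n) * (fps_X ^ E * fps_X ^ nat (a * j ^ 2 + b * j))"
      unfolding e power_add using vpow[of k] by (simp add: power_add mult_ac)
    finally have "q_binom (fps_X ^ (2 * A)) (2 * n) k * ((fps_X ^ (2 * A)) ^ (k choose 2) * v ^ k * (fps_X ^ s) ^ (2 * n - k))
      = q_binom (fps_X ^ (2 * A)) (2 * n) k * (v ^ n * v ^ (k + n) * (fps_X ^ E * fps_X ^ nat (a * j ^ 2 + b * j)))"
      by (rule arg_cong)
    then show "q_binom (fps_X ^ (2 * A)) (2 * n) k * (fps_X ^ (2 * A)) ^ (k choose 2) * v ^ k * (fps_X ^ s) ^ (2 * n - k)
      = v ^ n * fps_X ^ E * (q_binom (fps_X ^ (2 * A)) (2 * n) k * (v ^ (k + n) *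
            fps_X ^ nat (a * (int k - int n) ^ 2 + b * (int k - int n))))"
      unfolding j_def by (simp only: mult_ac)
  qed
  also have "\<dots> = v ^ n * fps_X ^ E * ?R"
    unfolding sum_distrib_left[symmetric] by (simp add: v_def a nat_mult_distrib fps_const_power)
  finally have "v ^ n * fps_X ^ E * ?L = v ^ n * fps_X ^ E * ?R" .
  moreover from v2 have "v \<noteq> 0" by auto
  then have "v ^ n * fps_X ^ E \<noteq> 0" by simp
  ultimately show ?thesis using mult_left_cancel by blast
qed simp

text \<open>In the finite form multiplied by (Q;Q)_n, Q = q^(2a), the coefficient (Q;Q)_n
  [2n choose k] is close to 1 for k near n. Where it is not, the monomial q^(a j^2 + b j), j = k -
  n, already has high order.\<close>

lemma jacobi_triple_product:
  fixes \<epsilon> :: "'a::field" and a b :: int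
  assumes ab: "\<bar>b\<bar> < a" and eps: "\<epsilon> ^ 2 = 1"
  shows "fps_cong n (theta \<epsilon> a b)
    (q_poch (fps_X ^ nat (2 * a)) n *
      (\<Prod>i<n. (1 + fps_const \<epsilon> * fps_X ^ nat (a * (2 * int i + 1) + b)) *
              (1 + fps_const \<epsilon> * fps_X ^ nat (a * (2 * int i + 1) - b))))"
proof -
  define P :: "nat \<Rightarrow> 'a fps" where "P = q_poch (fps_X ^ nat (2 * a))"
  define e where "e = (\<lambda>j::int. nat (a * j ^ 2 + b * j))"
  have a1: "nat (2 * a) \<ge> 2" using ab by simp
  have e: "nat \<bar>j\<bar> \<le> e j" for j
    using theta_exponent_ge[OF ab, of j] unfolding e_def by linarith
  have sgn: "\<epsilon> ^ nat \<bar>int k - int n\<bar> = \<epsilon> ^ (k + n)" for k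
  proof (cases "n \<le> k")
    case True
    then have "k + n = nat \<bar>int k - int n\<bar> + 2 * n" by simp
    then show ?thesis by (simp only: power_add power_mult eps) simp
  next
    case False
    then have "k + n = nat \<bar>int k - int n\<bar> + 2 * k" by simp
    then show ?thesis by (simp only: power_add power_mult eps) simp
  qed
  have "fps_cong n (theta \<epsilon> a b) (\<Sum>j\<in>{- int n..int n}. fps_const (\<epsilon> ^ nat \<bar>j\<bar>) * fps_X ^ e j)"
    unfolding theta_def e_def[symmetric]
  proof (rule weighted_gf_fps_cong)
    fix j assume "e j < n"
    then show "j \<in> {- int n..int n}" using e[of j] by auto
  qed auto
  also have "(\<Sum>j\<in>{- int n..int n}. fps_const (\<epsilon> ^ nat \<bar>j\<bar>) * fps_X ^ e j)
    = (\<Sum>k\<le>2 * n. fps_const (\<epsilon> ^ (k + n)) * fps_X ^ e (int k - int n))"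
  proof (rule sum.reindex_bij_witness[where i = "\<lambda>k. int k - int n" and j = "\<lambda>j. nat (j + int n)"])
    fix j assume "j \<in> {- int n..int n}"
    then show "fps_const (\<epsilon> ^ (nat (j + int n) + n)) * fps_X ^ e (int (nat (j + int n)) - int n) =
      fps_const (\<epsilon> ^ nat \<bar>j\<bar>) * fps_X ^ e j"
      using sgn[of "nat (j + int n)"] by simp
  qed auto
  also have "fps_cong n (\<Sum>k\<le>2 * n. fps_const (\<epsilon> ^ (k + n)) * fps_X ^ e (int k - int n))
    (\<Sum>k\<le>2 * n. P n * (q_binom (fps_X ^ nat (2 * a)) (2 * n) k * (fps_const (\<epsilon> ^ (k + n)) * fps_X ^ e (int k - int n))))"
  proof (rule fps_cong_sum)
    fix k assume "k \<in> {..2 * n}"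
    then have k: "k \<le> 2 * n" by simp
    define B where "B = q_binom (fps_X ^ nat (2 * a) :: 'a fps) (2 * n) k"
    \<comment> \<open>Equal to n - |k - n|; all Pochhammer products involved agree with
      \<open>P m\<close> up to order \<open>nat (2 * a) * Suc m\<close>.\<close>
    define m where "m = min k (2 * n - k)"
    have m: "m \<le> k" "m \<le> 2 * n - k" "m \<le> n" "m \<le> 2 * n" using k by (auto simp: m_def)
    have c: "fps_cong (nat (2 * a) * Suc m) (P N) (P m)" if "m \<le> N" for N
      unfolding P_def using a1 that by (intro q_poch_cong) auto
    define c where "c = P m"
    have "fps_nth c 0 \<noteq> 0" unfolding c_def P_def using a1 by (subst q_poch_nth_0) auto
    then have inv: "c * inverse c = 1" by (rule inverse_mult_eq_1')
    \<comment> \<open>Replacing all Pochhammer products by c in the quotient formula leaves B c^2 =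
      c, and the unit c cancels to give B c = 1 at this precision.\<close>
    have "fps_cong (nat (2 * a) * Suc m) (B * c * c) (B * P k * P (2 * n - k))"
      unfolding c_def using m by (intro fps_cong_mult fps_cong_refl c[THEN fps_cong_sym])
    also have "B * P k * P (2 * n - k) = P (2 * n)"
      unfolding B_def P_def using k by (rule q_binom_q_poch)
    also have "fps_cong (nat (2 * a) * Suc m) (P (2 * n)) c"
      unfolding c_def using m by (intro c)
    finally have "fps_cong (nat (2 * a) * Suc m) (B * c * c * inverse c) (c * inverse c)"
      by (rule fps_cong_mult) simp
    then have "fps_cong (nat (2 * a) * Suc m) (B * c) 1"
      by (simp add: mult.assoc inv)
    moreover have "fps_cong (nat (2 * a) * Suc m) (P n * B) (c * B)"
      unfolding c_def using m by (intro fps_cong_mult c fps_cong_refl)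
    ultimately have "fps_cong (nat (2 * a) * Suc m) 1 (P n * B)"
      by (metis fps_cong_sym fps_cong_trans mult.commute)
    then have "fps_cong (nat (2 * a) * Suc m) (fps_const (\<epsilon> ^ (k + n)) * 1) (fps_const (\<epsilon> ^ (k + n)) * (P n * B))"
      by (intro fps_cong_mult) auto
    from fps_cong_X_power_mult[OF this, of "e (int k - int n)"]
    have "fps_cong (e (int k - int n) + nat (2 * a) * Suc m)
      (fps_const (\<epsilon> ^ (k + n)) * fps_X ^ e (int k - int n))
      (P n * (B * (fps_const (\<epsilon> ^ (k + n)) * fps_X ^ e (int k - int n))))"
      by (simp add: mult_ac)
    \<comment> \<open>The exponent is at least |k - n| and the precision at least 2(m+1), while |k -
      n| + m = n.\<close>
    moreover have "n \<le> e (int k - int n) + nat (2 * a) * Suc m"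
    proof -
      have "n \<le> nat \<bar>int k - int n\<bar> + 2 * Suc m"
        using k by (auto simp: m_def min_def)
      also have "\<dots> \<le> e (int k - int n) + nat (2 * a) * Suc m"
        using e a1 by (intro add_mono mult_le_mono1)
      finally show ?thesis .
    qed
    ultimately show "fps_cong n (fps_const (\<epsilon> ^ (k + n)) * fps_X ^ e (int k - int n))
      (P n * (q_binom (fps_X ^ nat (2 * a)) (2 * n) k * (fps_const (\<epsilon> ^ (k + n)) * fps_X ^ e (int k - int n))))"
      unfolding B_def by (rule fps_cong_mono)
  qed
  also have "(\<Sum>k\<le>2 * n. P n * (q_binom (fps_X ^ nat (2 * a)) (2 * n) k * (fps_const (\<epsilon> ^ (k + n)) * fps_X ^ e (int k - int n))))
     = q_poch (fps_X ^ nat (2 * a)) n *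
      (\<Prod>i<n. (1 + fps_const \<epsilon> * fps_X ^ nat (a * (2 * int i + 1) + b)) *
              (1 + fps_const \<epsilon> * fps_X ^ nat (a * (2 * int i + 1) - b)))"
    unfolding jacobi_triple_product_finite[OF ab eps] P_def e_def sum_distrib_left ..
  finally show ?thesis .
qed

lemma jacobi_triple_product_minus:
  fixes a b :: nat
  assumes "b < a"
  shows "fps_cong n (theta (-1) (int a) (int b) :: 'a::field fps)
    (q_poch (fps_X ^ (2 * a)) n *
      (\<Prod>i<n. (1 - fps_X ^ (a * (2 * i + 1) + b)) * (1 - fps_X ^ (a * (2 * i + 1) - b))))"
proof -
  have "nat (int a * (2 * int i + 1) + int b) = a * (2 * i + 1) + b"
    "nat (int a * (2 * int i + 1) - int b) = a * (2 * i + 1) - b" for i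
    unfolding nat_minus_as_int by (simp_all add: algebra_simps nat_eq_iff)
  moreover have "1 + fps_const (-1) * F = 1 - F" for F :: "'a fps"
    by (simp flip: fps_const_neg)
  ultimately show ?thesis
    using jacobi_triple_product[of "int b" "int a" "-1 :: 'a" n] assms by (simp add: nat_mult_distrib)
qed

lemma jacobi_triple_product_plus:
  fixes a b :: nat
  assumes "b < a"
  shows "fps_cong n (theta 1 (int a) (int b) :: 'a::field fps)
    (q_poch (fps_X ^ (2 * a)) n *
      (\<Prod>i<n. (1 + fps_X ^ (a * (2 * i + 1) + b)) * (1 + fps_X ^ (a * (2 * i + 1) - b))))"
proof -
  have "nat (int a * (2 * int i + 1) + int b) = a * (2 * i + 1) + b"
    "nat (int a * (2 * int i + 1) - int b) = a * (2 * i + 1) - b" for i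
    unfolding nat_minus_as_int by (simp_all add: algebra_simps nat_eq_iff)
  then show ?thesis
    using jacobi_triple_product[of "int b" "int a" "1 :: 'a" n] assms by (simp add: nat_mult_distrib)
qed

section \<open>Product formulas for the theta series\<close>

lemma q_poch_times_2:
  "q_poch Q (2 * n) = q_poch (Q ^ 2) n * (\<Prod>i<n. 1 - Q ^ (2 * i + 1))"
proof (induction n)
  case (Suc n)
  have "q_poch Q (2 * Suc n) = q_poch Q (2 * n) * (1 - Q ^ (2 * n + 1)) * (1 - Q ^ (2 * n + 2))"
    by (simp add: q_poch_Suc)
  moreover have "q_poch (Q ^ 2) (Suc n) = q_poch (Q ^ 2) n * (1 - Q ^ (2 * n + 2))"
  proof -
    have "2 * Suc n = 2 * n + 2" by simp
    then show ?thesis by (simp only: q_poch_Suc power_mult[symmetric])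
  qed
  moreover note Suc.IH
  ultimately show ?case by (simp only: prod.lessThan_Suc mult_ac)
qed simp

lemma q_poch_times_3:
  "q_poch Q (3 * n) = q_poch (Q ^ 3) n * (\<Prod>i<n. (1 - Q ^ (3 * i + 1)) * (1 - Q ^ (3 * i + 2)))"
proof (induction n)
  case (Suc n)
  have "q_poch Q (3 * Suc n) = q_poch Q (3 * n) * (1 - Q ^ (3 * n + 1)) * (1 - Q ^ (3 * n + 2)) * (1 - Q ^ (3 * n + 3))"
    by (simp add: q_poch_Suc eval_nat_numeral)
  moreover have "q_poch (Q ^ 3) (Suc n) = q_poch (Q ^ 3) n * (1 - Q ^ (3 * n + 3))"
  proof -
    have "3 * Suc n = 3 * n + 3" by simp
    then show ?thesis by (simp only: q_poch_Suc power_mult[symmetric])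
  qed
  moreover note Suc.IH
  ultimately show ?case by (simp only: prod.lessThan_Suc mult_ac)
qed simp

lemma prod_times_2: "(\<Prod>i<2 * n. f i) = (\<Prod>i<n. f (2 * i) * f (2 * i + 1))" for f :: "nat \<Rightarrow> 'a::comm_monoid_mult"
  by (induction n) (simp_all add: mult_ac)

text \<open>Gauss's product for phi(-q^c): the triple product contains the odd factors twice, and
  each copy is completed to f_c by one factor f_(2c).\<close>

lemma theta_minus_0:
  assumes "c \<ge> 1"
  shows "theta (-1) (int c) 0 * euler_f (2 * c) = euler_f c ^ 2"
proof (rule fps_cong_eqI)
  fix n
  let ?O = "\<Prod>i<n. 1 - fps_X ^ (c * (2 * i + 1)) :: rat fps"
  have "fps_cong n (theta (-1) (int c) 0 * euler_f (2 * c))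
     (q_poch (fps_X ^ (2 * c)) n * (\<Prod>i<n. (1 - fps_X ^ (c * (2 * i + 1))) * (1 - fps_X ^ (c * (2 * i + 1)))) *
       q_poch (fps_X ^ (2 * c)) n)"
    using jacobi_triple_product_minus[of 0 c n] assms by (intro fps_cong_mult euler_f_cong_ge) simp_all
  also have "\<dots> = (q_poch (fps_X ^ (2 * c)) n * ?O) ^ 2"
    by (simp only: prod.distrib power2_eq_square mult_ac)
  also have "q_poch (fps_X ^ (2 * c)) n * ?O = q_poch (fps_X ^ c) (2 * n)"
    unfolding q_poch_times_2 power_mult[symmetric] by (simp only: mult.commute)
  also have "fps_cong n (q_poch (fps_X ^ c) (2 * n) ^ 2) (euler_f c ^ 2)"
    using assms by (intro fps_cong_power fps_cong_sym[OF euler_f_cong_ge]) auto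
  finally show "fps_cong n (theta (-1) (int c) 0 * euler_f (2 * c)) (euler_f c ^ 2)" .
qed

text \<open>Inclusion-exclusion: the exponents prime to 6 are all exponents, less the multiples of 2
  and of 3, with the multiples of 6 restored.\<close>

lemma q_poch_mod_6:
  fixes Q :: "'a::comm_ring_1"
  shows "(\<Prod>i<n. (1 - Q ^ (6 * i + 5)) * (1 - Q ^ (6 * i + 1))) * q_poch (Q ^ 2) (3 * n) * q_poch (Q ^ 3) (2 * n)
    = q_poch Q (6 * n) * q_poch (Q ^ 6) n"
proof -
  have "q_poch Q (6 * n) = q_poch (Q ^ 3) (2 * n) * (\<Prod>i<2 * n. (1 - Q ^ (3 * i + 1)) * (1 - Q ^ (3 * i + 2)))"
    using q_poch_times_3[of Q "2 * n"] by simp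
  moreover have "(\<Prod>i<2 * n. (1 - Q ^ (3 * i + 1)) * (1 - Q ^ (3 * i + 2)))
    = (\<Prod>i<n. (1 - Q ^ (6 * i + 5)) * (1 - Q ^ (6 * i + 1))) * (\<Prod>i<n. (1 - (Q ^ 2) ^ (3 * i + 1)) * (1 - (Q ^ 2) ^ (3 * i + 2)))"
    unfolding prod_times_2 prod.distrib[symmetric] power_mult[symmetric]
  proof (rule prod.cong[OF refl])
    fix i :: nat
    have "3 * (2 * i) + 1 = 6 * i + 1" "3 * (2 * i) + 2 = 2 * (3 * i + 1)"
      "3 * (2 * i + 1) + 1 = 2 * (3 * i + 2)" "3 * (2 * i + 1) + 2 = 6 * i + 5"
      by simp_all
    then show "(1 - Q ^ (3 * (2 * i) + 1)) * (1 - Q ^ (3 * (2 * i) + 2)) *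
        ((1 - Q ^ (3 * (2 * i + 1) + 1)) * (1 - Q ^ (3 * (2 * i + 1) + 2))) =
      (1 - Q ^ (6 * i + 5)) * (1 - Q ^ (6 * i + 1)) *
        ((1 - Q ^ (2 * (3 * i + 1))) * (1 - Q ^ (2 * (3 * i + 2))))"
      by (simp only: mult_ac)
  qed
  moreover have "q_poch (Q ^ 2) (3 * n) = q_poch (Q ^ 6) n * (\<Prod>i<n. (1 - (Q ^ 2) ^ (3 * i + 1)) * (1 - (Q ^ 2) ^ (3 * i + 2)))"
    using q_poch_times_3[of "Q ^ 2" n] by (simp flip: power_mult)
  ultimately show ?thesis by (simp only: mult_ac)
qed

text \<open>The exponents 3(2i+1) + 2 and 3(2i+1) - 2 are 6i+5 and 6i+1, so the triple product runs
  over the exponents prime to 6.\<close>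

lemma theta_minus_3_2:
  assumes "c \<ge> 1"
  shows "theta (-1) (int (3 * c)) (int (2 * c)) * euler_f (2 * c) * euler_f (3 * c) = euler_f c * euler_f (6 * c) ^ 2"
proof (rule fps_cong_eqI)
  fix n
  define Q :: "rat fps" where "Q = fps_X ^ c"
  let ?O = "\<Prod>i<n. (1 - Q ^ (6 * i + 5)) * (1 - Q ^ (6 * i + 1))"
  have "fps_cong n (theta (-1) (int (3 * c)) (int (2 * c)) * euler_f (2 * c) * euler_f (3 * c))
     (q_poch (fps_X ^ (2 * (3 * c))) n * (\<Prod>i<n. (1 - fps_X ^ (3 * c * (2 * i + 1) + 2 * c)) * (1 - fps_X ^ (3 * c * (2 * i + 1) - 2 * c))) *
       q_poch (fps_X ^ (2 * c)) (3 * n) * q_poch (fps_X ^ (3 * c)) (2 * n))"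
    using assms by (intro fps_cong_mult euler_f_cong_ge jacobi_triple_product_minus) simp_all
  also have "(\<Prod>i<n. (1 - fps_X ^ (3 * c * (2 * i + 1) + 2 * c)) * (1 - fps_X ^ (3 * c * (2 * i + 1) - 2 * c))) = ?O"
  proof (rule prod.cong[OF refl])
    fix i
    have "3 * c * (2 * i + 1) + 2 * c = c * (6 * i + 5)" "3 * c * (2 * i + 1) - 2 * c = c * (6 * i + 1)"
      by (simp_all add: algebra_simps)
    then show "(1 - fps_X ^ (3 * c * (2 * i + 1) + 2 * c)) * (1 - fps_X ^ (3 * c * (2 * i + 1) - 2 * c)) =
      (1 - Q ^ (6 * i + 5)) * (1 - Q ^ (6 * i + 1))"
      unfolding Q_def power_mult[symmetric] by simp
  qed
  also have "q_poch (fps_X ^ (2 * (3 * c))) n * ?O * q_poch (fps_X ^ (2 * c)) (3 * n) * q_poch (fps_X ^ (3 * c)) (2 * n)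
    = q_poch (Q ^ 6) n * (?O * q_poch (Q ^ 2) (3 * n) * q_poch (Q ^ 3) (2 * n))"
    by (simp add: Q_def mult_ac flip: power_mult)
  also have "\<dots> = q_poch (fps_X ^ c) (6 * n) * q_poch (fps_X ^ (6 * c)) n ^ 2"
    unfolding q_poch_mod_6 by (simp add: Q_def power2_eq_square mult_ac flip: power_mult)
  also have "fps_cong n \<dots> (euler_f c * euler_f (6 * c) ^ 2)"
    using assms by (intro fps_cong_mult fps_cong_power fps_cong_sym[OF euler_f_cong_ge]) auto
  finally show "fps_cong n (theta (-1) (int (3 * c)) (int (2 * c)) * euler_f (2 * c) * euler_f (3 * c)) (euler_f c * euler_f (6 * c) ^ 2)" .
qed

text \<open>Euler's pentagonal number theorem in q^4, since 6j^2 + 2j = 4 j(3j+1)/2.\<close>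

lemma theta_minus_6_2: "theta (-1) 6 2 = euler_f 4"
proof (rule fps_cong_eqI)
  fix n
  define Q :: "rat fps" where "Q = fps_X ^ 4"
  have "fps_cong n (theta (-1) 6 2)
     (q_poch (fps_X ^ 12) n * (\<Prod>i<n. (1 - fps_X ^ (6 * (2 * i + 1) + 2)) * (1 - fps_X ^ (6 * (2 * i + 1) - 2))) :: rat fps)"
    using jacobi_triple_product_minus[of 2 6 n] by simp
  also have "(\<Prod>i<n. (1 - fps_X ^ (6 * (2 * i + 1) + 2)) * (1 - fps_X ^ (6 * (2 * i + 1) - 2)))
    = (\<Prod>i<n. (1 - Q ^ (3 * i + 1)) * (1 - Q ^ (3 * i + 2)))"
  proof (rule prod.cong[OF refl])
    fix i :: nat
    have "6 * (2 * i + 1) + 2 = 4 * (3 * i + 2)" "6 * (2 * i + 1) - 2 = 4 * (3 * i + 1)"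
      by (simp_all add: algebra_simps)
    then show "(1 - fps_X ^ (6 * (2 * i + 1) + 2)) * (1 - fps_X ^ (6 * (2 * i + 1) - 2)) =
      (1 - Q ^ (3 * i + 1)) * (1 - Q ^ (3 * i + 2))"
      unfolding Q_def power_mult[symmetric] by (simp add: mult.commute)
  qed
  also have "q_poch (fps_X ^ 12) n * \<dots> = q_poch Q (3 * n)"
    unfolding q_poch_times_3 by (simp add: Q_def flip: power_mult)
  also have "fps_cong n \<dots> (euler_f 4)"
    unfolding Q_def by (intro fps_cong_sym[OF euler_f_cong_ge]) auto
  finally show "fps_cong n (theta (-1) 6 2) (euler_f 4)" .
qed

text \<open>Multiplying by the series with alternating signs turns each 1 + x into 1 - x^2, and
  doubling the exponents gives the product for \<open>theta (-1) 6 4\<close>.\<close>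

lemma theta_plus_3_2:
  "theta 1 3 2 * theta (-1) 3 2 * euler_f 12 = theta (-1) 6 4 * euler_f 6 ^ 2"
proof (rule fps_cong_eqI)
  fix n
  let ?P = "\<lambda>m. q_poch (fps_X ^ m) n :: rat fps"
  let ?p = "\<Prod>i<n. (1 + fps_X ^ (3 * (2 * i + 1) + 2)) * (1 + fps_X ^ (3 * (2 * i + 1) - 2)) :: rat fps"
  let ?m = "\<Prod>i<n. (1 - fps_X ^ (3 * (2 * i + 1) + 2)) * (1 - fps_X ^ (3 * (2 * i + 1) - 2)) :: rat fps"
  let ?d = "\<Prod>i<n. (1 - fps_X ^ (6 * (2 * i + 1) + 4)) * (1 - fps_X ^ (6 * (2 * i + 1) - 4)) :: rat fps"
  have "fps_cong n (theta 1 3 2 * theta (-1) 3 2 * euler_f 12) (?P 6 * ?p * (?P 6 * ?m) * ?P 12)"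
    using jacobi_triple_product_minus[of 2 3 n, where 'a = rat] jacobi_triple_product_plus[of 2 3 n, where 'a = rat]
    by (intro fps_cong_mult euler_f_cong_ge) simp_all
  also have "?P 6 * ?p * (?P 6 * ?m) * ?P 12 = ?P 12 * (?p * ?m) * ?P 6 ^ 2"
    by (simp only: power2_eq_square mult_ac)
  also have "?p * ?m = ?d"
    unfolding prod.distrib[symmetric]
  proof (rule prod.cong[OF refl])
    fix i :: nat
    have "6 * (2 * i + 1) + 4 = (3 * (2 * i + 1) + 2) + (3 * (2 * i + 1) + 2)"
      "6 * (2 * i + 1) - 4 = (3 * (2 * i + 1) - 2) + (3 * (2 * i + 1) - 2)"
      by simp_all
    moreover have "(1 + x) * (1 + y) * ((1 - x) * (1 - y)) = (1 - x * x) * (1 - y * y)" for x y :: "rat fps"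
      by (simp add: algebra_simps)
    ultimately show "(1 + fps_X ^ (3 * (2 * i + 1) + 2)) * (1 + fps_X ^ (3 * (2 * i + 1) - 2)) *
      ((1 - fps_X ^ (3 * (2 * i + 1) + 2)) * (1 - fps_X ^ (3 * (2 * i + 1) - 2))) =
      (1 - fps_X ^ (6 * (2 * i + 1) + 4)) * (1 - fps_X ^ (6 * (2 * i + 1) - 4) :: rat fps)"
      by (simp only: power_add)
  qed
  also have "fps_cong n (?P 12 * ?d * ?P 6 ^ 2) (theta (-1) 6 4 * euler_f 6 ^ 2)"
    using jacobi_triple_product_minus[of 4 6 n, where 'a = rat]
    by (intro fps_cong_mult fps_cong_power fps_cong_sym[OF euler_f_cong_ge] fps_cong_sym[of n "theta (-1) 6 4"]) simp_all
  finally show "fps_cong n (theta 1 3 2 * theta (-1) 3 2 * euler_f 12) (theta (-1) 6 4 * euler_f 6 ^ 2)" .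
qed

subsection \<open>Dissections of theta series\<close>

lemma minus_one_power_nat_abs:
  "(-1) ^ nat \<bar>j\<bar> = (if even j then 1 else -1 :: 'a::comm_ring_1)"
  by (simp add: minus_one_power_iff even_nat_iff)

lemma int_theta_exponent:
  fixes a b j :: int
  assumes "\<bar>b\<bar> < a"
  shows "int (nat (a * j ^ 2 + b * j)) = a * j ^ 2 + b * j"
  using theta_exponent_ge[OF assms, of j] by simp

text \<open>For m + n even put m = a - b, n = a + b; this diagonalises 3m^2 + 3n^2 + 2n and
  separates the variables. Both 6j^2 + 2j and 6j^2 + 4j are even, so the two summands are the even
  and the odd part.\<close>

lemma theta_product_dissection:
  "(theta (-1) 3 0 * theta 1 3 2 :: 'a::comm_ring_1 fps) = theta (-1) 6 2 ^ 2 + fps_X * theta (-1) 6 4 ^ 2"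
proof -
  let ?e = "\<lambda>(m::int, n::int). nat (3 * m ^ 2 + 0 * m) + nat (3 * n ^ 2 + 2 * n)"
  let ?w = "\<lambda>(m::int, n::int). (-1) ^ nat \<bar>m\<bar> * 1 ^ nat \<bar>n\<bar> :: 'a"
  let ?A = "{(m, n). even (m + n)} :: (int \<times> int) set"
  let ?B = "{(m, n). odd (m + n)} :: (int \<times> int) set"
  have te: "int (nat (3 * j ^ 2 + 0 * j)) = 3 * j ^ 2 + 0 * j" "int (nat (3 * j ^ 2 + 2 * j)) = 3 * j ^ 2 + 2 * j"
    "int (nat (6 * j ^ 2 + 2 * j)) = 6 * j ^ 2 + 2 * j" "int (nat (6 * j ^ 2 + 4 * j)) = 6 * j ^ 2 + 4 * j" for j :: int
    by (rule int_theta_exponent; simp)+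
  have fin: "finite {x \<in> C. ?e x = k}" for C k
  proof (rule finite_subset)
    show "{x \<in> C. ?e x = k} \<subseteq> {- int k..int k} \<times> {- int k..int k}"
    proof
      fix x assume x: "x \<in> {x \<in> C. ?e x = k}"
      obtain m n where mn: "x = (m, n)" by force
      have "nat (3 * m ^ 2 + 0 * m) + nat (3 * n ^ 2 + 2 * n) = k" using x mn by simp
      then show "x \<in> {- int k..int k} \<times> {- int k..int k}"
        using theta_exponent_ge[of 0 3 m] theta_exponent_ge[of 2 3 n]
        unfolding mn mem_Times_iff fst_conv snd_conv atLeastAtMost_iff by linarith
    qed
  qed simp
  have "theta (-1) 3 0 * theta 1 3 2 = weighted_gf (?A \<union> ?B) ?e ?w"
    unfolding theta_def
    by (subst weighted_gf_mult) (use finite_theta_fibre[of 0 3 "\<lambda>_. True"] finite_theta_fibre[of 2 3 "\<lambda>_. True"] in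
      \<open>auto intro!: arg_cong[where f = "\<lambda>S. weighted_gf S _ _"]\<close>)
  also have "\<dots> = weighted_gf ?A ?e ?w + weighted_gf ?B ?e ?w"
    by (rule weighted_gf_Un[OF _ fin fin]) auto
  also have "weighted_gf ?A ?e ?w = theta (-1) 6 2 ^ 2"
  proof -
    let ?e' = "\<lambda>(a::int, b::int). nat (6 * a ^ 2 + 2 * a) + nat (6 * b ^ 2 + 2 * b)"
    let ?w' = "\<lambda>(a::int, b::int). (-1) ^ nat \<bar>a\<bar> * (-1) ^ nat \<bar>b\<bar> :: 'a"
    have "weighted_gf ?A ?e ?w = weighted_gf (UNIV \<times> UNIV) ?e' ?w'"
    proof (rule weighted_gf_reindex[where g = "\<lambda>(a, b). (a - b, a + b)"])
      show "bij_betw (\<lambda>(a, b). (a - b, a + b)) (UNIV \<times> UNIV) ?A"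
        by (rule bij_betw_byWitness[where f' = "\<lambda>(m, n). ((m + n) div 2, (n - m) div 2)"]) (auto, presburger+)
    next
      fix x :: "int \<times> int"
      obtain a b where x: "x = (a, b)" by force
      have "int (?e (a - b, a + b)) = int (?e' (a, b))"
        unfolding case_prod_conv of_nat_add te
        by (simp add: power2_eq_square algebra_simps)
      then show "?e (case x of (a, b) \<Rightarrow> (a - b, a + b)) = ?e' x"
        unfolding x by (simp only: case_prod_conv of_nat_eq_iff)
      show "?w (case x of (a, b) \<Rightarrow> (a - b, a + b)) = ?w' x"
        unfolding x by (simp add: minus_one_power_nat_abs)
    qed
    also have "\<dots> = theta (-1) 6 2 ^ 2"
      unfolding theta_def power2_eq_square[of "weighted_gf _ _ _"]
      by (rule weighted_gf_mult[symmetric]) (use finite_theta_fibre[of 2 6 "\<lambda>_. True"] in auto)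
    finally show ?thesis .
  qed
  also have "weighted_gf ?B ?e ?w = fps_X * theta (-1) 6 4 ^ 2"
  proof -
    let ?e' = "\<lambda>(a::int, b::int). nat (6 * a ^ 2 + 4 * a) + nat (6 * b ^ 2 + 4 * b)"
    let ?w' = "\<lambda>(a::int, b::int). (-1) ^ nat \<bar>a\<bar> * (-1) ^ nat \<bar>b\<bar> :: 'a"
    have "weighted_gf ?B ?e ?w = weighted_gf (UNIV \<times> UNIV) (\<lambda>x. 1 + ?e' x) ?w'"
    \<comment> \<open>The substitution n = a + b + 1 would give linear coefficient 8, outside the
      range |b| < a of the theta series; negating n gives coefficient 4 and constant 1, the factor
      \<open>fps_X\<close>.\<close>
    proof (rule weighted_gf_reindex[where g = "\<lambda>(a, b). (a - b, - a - b - 1)"])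
      show "bij_betw (\<lambda>(a, b). (a - b, - a - b - 1)) (UNIV \<times> UNIV) ?B"
        by (rule bij_betw_byWitness[where f' = "\<lambda>(m, n). ((m - n - 1) div 2, (- m - n - 1) div 2)"])
           (auto, presburger+)
    next
      fix x :: "int \<times> int"
      obtain a b where x: "x = (a, b)" by force
      have "int (?e (a - b, - a - b - 1)) = int (1 + ?e' (a, b))"
        unfolding case_prod_conv of_nat_add te
        by (simp add: power2_eq_square algebra_simps)
      then show "?e (case x of (a, b) \<Rightarrow> (a - b, - a - b - 1)) = 1 + ?e' x"
        unfolding x by (simp only: case_prod_conv of_nat_eq_iff)
      show "?w (case x of (a, b) \<Rightarrow> (a - b, - a - b - 1)) = ?w' x"
        unfolding x by (simp add: minus_one_power_nat_abs)
    qed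
    also have "\<dots> = fps_X ^ 1 * weighted_gf (UNIV \<times> UNIV) ?e' ?w'"
      by (rule weighted_gf_shift)
    also have "weighted_gf (UNIV \<times> UNIV) ?e' ?w' = theta (-1) 6 4 ^ 2"
      unfolding theta_def power2_eq_square[of "weighted_gf _ _ _"]
      by (rule weighted_gf_mult[symmetric]) (use finite_theta_fibre[of 4 6 "\<lambda>_. True"] in auto)
    finally show ?thesis by simp
  qed
  finally show ?thesis .
qed

text \<open>Negation swaps the index classes 1 and 2 modulo 3, so they contribute equally; (3j+1)^2
  = 1 + 9j^2 + 6j, and the odd shift produces the minus sign.\<close>

lemma theta_dissection_3:
  "(theta (-1) 1 0 :: 'a::comm_ring_1 fps) = theta (-1) 9 0 - 2 * fps_X * theta (-1) 9 6"
proof -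
  let ?e = "\<lambda>j::int. nat (1 * j ^ 2 + 0 * j)"
  let ?w = "\<lambda>j::int. (-1) ^ nat \<bar>j\<bar> :: 'a"
  let ?A = "\<lambda>r. {j::int. j mod 3 = r}"
  have fin: "finite {x \<in> C. ?e x = k}" for C k
    by (rule finite_theta_fibre) simp
  have bij0: "bij_betw (\<lambda>j. 3 * j) UNIV (?A 0)"
    by (rule bij_betw_byWitness[where f' = "\<lambda>j. j div 3"]) auto
  have bij1: "bij_betw (\<lambda>j. 3 * j + 1) UNIV (?A 1)"
    by (rule bij_betw_byWitness[where f' = "\<lambda>j. (j - 1) div 3"]) (auto, presburger)
  \<comment> \<open>Class 2 is written as -3j - 1 rather than 3j + 2 so that its exponents agree
    with those of class 1 term by term.\<close>
  have bij2: "bij_betw (\<lambda>j. - 3 * j - 1) UNIV (?A 2)"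
    by (rule bij_betw_byWitness[where f' = "\<lambda>j. (- j - 1) div 3"]) (auto, presburger+)
  have "UNIV = ?A 0 \<union> (?A 1 \<union> ?A 2)" by auto
  then have "theta (-1) 1 0 = weighted_gf (?A 0 \<union> (?A 1 \<union> ?A 2)) ?e ?w"
    unfolding theta_def by simp
  also have "\<dots> = weighted_gf (?A 0) ?e ?w + weighted_gf (?A 1 \<union> ?A 2) ?e ?w"
    by (rule weighted_gf_Un[OF _ fin fin]) auto
  also have "weighted_gf (?A 1 \<union> ?A 2) ?e ?w = weighted_gf (?A 1) ?e ?w + weighted_gf (?A 2) ?e ?w"
    by (rule weighted_gf_Un[OF _ fin fin]) auto
  also have "weighted_gf (?A 0) ?e ?w = theta (-1) 9 0"
    unfolding theta_def
    by (rule weighted_gf_reindex[OF bij0]) (auto simp: minus_one_power_nat_abs power2_eq_square)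
  also have neg: "fps_X ^ 1 * - theta (-1) 9 6 =
      weighted_gf UNIV (\<lambda>j. 1 + nat (9 * j ^ 2 + 6 * j)) (\<lambda>j. - ((-1) ^ nat \<bar>j\<bar>) :: 'a)"
    unfolding theta_def weighted_gf_shift weighted_gf_uminus ..
  have ex: "nat (1 * (3 * j + 1) ^ 2 + 0 * (3 * j + 1)) = 1 + nat (9 * j ^ 2 + 6 * j)"
    "nat (1 * (- 3 * j - 1) ^ 2 + 0 * (- 3 * j - 1)) = 1 + nat (9 * j ^ 2 + 6 * j)" for j :: int
  proof -
    have "9 * j ^ 2 + 6 * j \<ge> 0" using theta_exponent_ge[of 6 9 j] by simp
    then have "1 + nat (9 * j ^ 2 + 6 * j) = nat (1 + (9 * j ^ 2 + 6 * j))" by simp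
    then show "nat (1 * (3 * j + 1) ^ 2 + 0 * (3 * j + 1)) = 1 + nat (9 * j ^ 2 + 6 * j)"
      "nat (1 * (- 3 * j - 1) ^ 2 + 0 * (- 3 * j - 1)) = 1 + nat (9 * j ^ 2 + 6 * j)"
      by (simp_all only:) (simp_all add: power2_eq_square algebra_simps)
  qed
  have "weighted_gf (?A 1) ?e ?w = fps_X ^ 1 * - theta (-1) 9 6"
    unfolding neg by (rule weighted_gf_reindex[OF bij1]) (use ex in \<open>auto simp: minus_one_power_nat_abs\<close>)
  moreover have "weighted_gf (?A 2) ?e ?w = fps_X ^ 1 * - theta (-1) 9 6"
    unfolding neg by (rule weighted_gf_reindex[OF bij2]) (use ex in \<open>auto simp: minus_one_power_nat_abs\<close>)
  ultimately show ?thesis by simp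
qed

subsection \<open>The cubic norm\<close>

text \<open>Exponents are kept and not divided by 3, so the parts add up to the series and form a
  grading by the integers modulo 3.\<close>

definition residue_part :: "nat \<Rightarrow> 'a::comm_ring_1 fps \<Rightarrow> 'a fps" where
  "residue_part r F = Abs_fps (\<lambda>n. if n mod 3 = r then fps_nth F n else 0)"

definition norm3 :: "'a::comm_ring_1 fps \<Rightarrow> 'a fps" where
  "norm3 F = residue_part 0 F ^ 3 + residue_part 1 F ^ 3 + residue_part 2 F ^ 3
     - 3 * (residue_part 0 F * residue_part 1 F * residue_part 2 F)"

lemma residue_part_sum: "F = residue_part 0 F + residue_part 1 F + residue_part 2 F"
proof (rule fps_ext)
  fix n :: nat
  have "n mod 3 = 0 \<or> n mod 3 = 1 \<or> n mod 3 = 2" by presburger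
  then show "fps_nth F n = fps_nth (residue_part 0 F + residue_part 1 F + residue_part 2 F) n"
    by (auto simp: residue_part_def)
qed

lemma residue_part_add: "residue_part r (F + G) = residue_part r F + residue_part r G"
  by (rule fps_ext) (simp add: residue_part_def)

lemma residue_part_mult_parts:
  assumes "r < 3"
  shows "residue_part r (residue_part i F * residue_part j G) =
    (if (i + j) mod 3 = r then residue_part i F * residue_part j G else 0)"
proof (rule fps_ext)
  fix n
  have "fps_nth (residue_part i F * residue_part j G) n = 0" if "n mod 3 \<noteq> (i + j) mod 3"
    unfolding fps_mult_nth
  proof (rule sum.neutral, intro ballI)
    fix k assume "k \<in> {0..n}"
    then have "n mod 3 = (k mod 3 + (n - k) mod 3) mod 3" by (simp add: mod_add_eq)
    with that have "k mod 3 \<noteq> i \<or> (n - k) mod 3 \<noteq> j" by auto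
    then show "fps_nth (residue_part i F) k * fps_nth (residue_part j G) (n - k) = 0"
      by (auto simp: residue_part_def)
  qed
  then show "fps_nth (residue_part r (residue_part i F * residue_part j G)) n =
    fps_nth (if (i + j) mod 3 = r then residue_part i F * residue_part j G else 0) n"
    by (simp add: residue_part_def[of r])
qed

lemma residue_part_mult:
  "residue_part 0 (F * G) = residue_part 0 F * residue_part 0 G + residue_part 1 F * residue_part 2 G + residue_part 2 F * residue_part 1 G"
  "residue_part 1 (F * G) = residue_part 0 F * residue_part 1 G + residue_part 1 F * residue_part 0 G + residue_part 2 F * residue_part 2 G"
  "residue_part 2 (F * G) = residue_part 0 F * residue_part 2 G + residue_part 1 F * residue_part 1 G + residue_part 2 F * residue_part 0 G"
proof -
  have FG: "F * G = residue_part 0 F * residue_part 0 G + residue_part 0 F * residue_part 1 G + residue_part 0 F * residue_part 2 G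
    + residue_part 1 F * residue_part 0 G + residue_part 1 F * residue_part 1 G + residue_part 1 F * residue_part 2 G
    + residue_part 2 F * residue_part 0 G + residue_part 2 F * residue_part 1 G + residue_part 2 F * residue_part 2 G"
    (is "_ = ?S")
  proof -
    have "F * G = (residue_part 0 F + residue_part 1 F + residue_part 2 F) * (residue_part 0 G + residue_part 1 G + residue_part 2 G)"
      unfolding residue_part_sum[symmetric] ..
    also have "\<dots> = ?S" by (simp only: distrib_left distrib_right add_ac)
    finally show ?thesis .
  qed
  show "residue_part 0 (F * G) = residue_part 0 F * residue_part 0 G + residue_part 1 F * residue_part 2 G + residue_part 2 F * residue_part 1 G"
    "residue_part 1 (F * G) = residue_part 0 F * residue_part 1 G + residue_part 1 F * residue_part 0 G + residue_part 2 F * residue_part 2 G"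
    "residue_part 2 (F * G) = residue_part 0 F * residue_part 2 G + residue_part 1 F * residue_part 1 G + residue_part 2 F * residue_part 0 G"
    unfolding FG by (simp_all add: residue_part_add residue_part_mult_parts)
qed

text \<open>The form a^3 + b^3 + c^3 - 3abc is the determinant of a circulant matrix, and circulants
  multiply by cyclic convolution of their first rows.\<close>

lemma circulant_det_mult:
  fixes a b c x y z :: "'a::comm_ring_1"
  shows "(a * x + b * z + c * y) ^ 3 + (a * y + b * x + c * z) ^ 3 + (a * z + b * y + c * x) ^ 3
    - 3 * ((a * x + b * z + c * y) * (a * y + b * x + c * z) * (a * z + b * y + c * x)) =
    (a ^ 3 + b ^ 3 + c ^ 3 - 3 * (a * b * c)) * (x ^ 3 + y ^ 3 + z ^ 3 - 3 * (x * y * z))"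
  by (simp add: algebra_simps power3_eq_cube)

text \<open>\<^term>\<open>norm3 F\<close> is the product of \<open>F(\<omega>\<^sup>i q)\<close> over the cube roots of unity, written as
  the circulant determinant of the residue parts so that no roots of unity have to be adjoined.\<close>

lemma norm3_mult: "norm3 (F * G) = norm3 F * norm3 G"
  unfolding norm3_def residue_part_mult circulant_det_mult[symmetric] by (simp only: add_ac mult_ac)

lemma norm3_cong:
  assumes "fps_cong n F G"
  shows "fps_cong n (norm3 F) (norm3 G)"
proof -
  have "fps_cong n (residue_part r F) (residue_part r G)" for r
    using assms by (simp add: fps_cong_def residue_part_def)
  then show ?thesis
    unfolding norm3_def by (intro fps_cong_add fps_cong_diff fps_cong_mult fps_cong_power fps_cong_refl)
qed

lemma norm3_eq_cube:
  assumes "\<And>n. n mod 3 \<noteq> 0 \<Longrightarrow> fps_nth F n = 0"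
  shows "norm3 F = F ^ 3"
proof -
  have "residue_part 0 F = F" "residue_part 1 F = 0" "residue_part 2 F = 0"
    using assms by (auto simp: residue_part_def fps_eq_iff)
  then show ?thesis by (simp add: norm3_def)
qed

lemma norm3_two_terms:
  assumes "\<And>n. n mod 3 \<noteq> 0 \<Longrightarrow> fps_nth A n = 0" "\<And>n. n mod 3 \<noteq> r \<Longrightarrow> fps_nth B n = 0"
    and "r \<in> {1, 2}"
  shows "norm3 (A + B) = A ^ 3 + B ^ 3"
proof -
  have "residue_part i (A + B) = (if i = 0 then A else if i = r then B else 0)" if "i < 3" for i
    using assms by (auto simp: residue_part_def fps_eq_iff)
  from this[of 0] this[of 1] this[of 2] show ?thesis using assms(3) by (auto simp: norm3_def)
qed

text \<open>If 3 divides m, the three conjugates coincide; otherwise they are the three factors of 1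
  - q^(3m) over the cube roots of unity.\<close>

lemma norm3_one_minus_X_power:
  "norm3 (1 - fps_X ^ m :: 'a::comm_ring_1 fps) = (if 3 dvd m then (1 - fps_X ^ m) ^ 3 else 1 - fps_X ^ (3 * m))"
proof (cases "3 dvd m")
  case True
  then have "norm3 (1 - fps_X ^ m :: 'a fps) = (1 - fps_X ^ m) ^ 3"
    by (intro norm3_eq_cube) auto
  then show ?thesis using True by simp
next
  case False
  have "norm3 (1 + - (fps_X ^ m) :: 'a fps) = 1 ^ 3 + (- (fps_X ^ m)) ^ 3"
  proof (rule norm3_two_terms[where r = "m mod 3"])
    show "m mod 3 \<in> {1, 2}" using False by (simp, presburger)
  qed auto
  then show ?thesis using False by (simp add: power_mult[symmetric] mult.commute)
qed

lemma norm3_1 [simp]: "norm3 1 = 1"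
  by (subst norm3_eq_cube) auto

lemma norm3_prod: "norm3 (\<Prod>i\<in>I. f i) = (\<Prod>i\<in>I. norm3 (f i))"
  by (induction I rule: infinite_finite_induct) (simp_all add: norm3_mult)

text \<open>Factors at multiples of 3 are cubed; the others become factors in q^(3c) with the
  multiples of 3 left out, and (q^(9c);q^(9c))_n restores these.\<close>

lemma norm3_q_poch:
  fixes c :: nat
  assumes "\<not> 3 dvd c"
  shows "norm3 (q_poch (fps_X ^ c :: 'a::comm_ring_1 fps) (3 * n)) * q_poch (fps_X ^ (9 * c)) n =
    q_poch (fps_X ^ (3 * c)) (3 * n) * q_poch (fps_X ^ (3 * c)) n ^ 3"
proof -
  let ?O = "\<Prod>i<n. (1 - fps_X ^ (3 * (c * (3 * i + 1)))) * (1 - fps_X ^ (3 * (c * (3 * i + 2)))) :: 'a fps"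
  have nd: "\<not> 3 dvd c * (3 * i + 1)" "\<not> 3 dvd c * (3 * i + 2)" for i
  proof -
    have "\<not> 3 dvd 3 * i + 1" "\<not> 3 dvd 3 * i + 2" by presburger+
    moreover have "prime (3::nat)" by simp
    ultimately show "\<not> 3 dvd c * (3 * i + 1)" "\<not> 3 dvd c * (3 * i + 2)"
      using assms by (metis prime_dvd_mult_iff)+
  qed
  have "norm3 (q_poch (fps_X ^ c) (3 * n) :: 'a fps) =
    norm3 (q_poch (fps_X ^ (3 * c)) n) * (\<Prod>i<n. norm3 (1 - fps_X ^ (c * (3 * i + 1))) * norm3 (1 - fps_X ^ (c * (3 * i + 2))))"
    unfolding q_poch_times_3 norm3_mult norm3_prod power_mult[symmetric] by (simp only: mult.commute)
  also have "norm3 (q_poch (fps_X ^ (3 * c)) n :: 'a fps) = q_poch (fps_X ^ (3 * c)) n ^ 3"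
    unfolding q_poch_def norm3_prod power_mult[symmetric] norm3_one_minus_X_power by (simp add: prod_power_distrib)
  also have "(\<Prod>i<n. norm3 (1 - fps_X ^ (c * (3 * i + 1))) * norm3 (1 - fps_X ^ (c * (3 * i + 2)))) = ?O"
    unfolding norm3_one_minus_X_power using nd by (simp only: if_False)
  finally have "norm3 (q_poch (fps_X ^ c) (3 * n) :: 'a fps) = q_poch (fps_X ^ (3 * c)) n ^ 3 * ?O" .
  moreover have "q_poch (fps_X ^ (3 * c) :: 'a fps) (3 * n) = q_poch (fps_X ^ (9 * c)) n * ?O"
  proof -
    have "3 * c * 3 = 9 * c" by simp
    then show ?thesis unfolding q_poch_times_3 power_mult[symmetric] by (simp only: mult.assoc)
  qed
  ultimately show ?thesis by (simp only: mult_ac)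
qed

lemma norm3_euler_f:
  assumes "\<not> 3 dvd c"
  shows "norm3 (euler_f c) * euler_f (9 * c) = euler_f (3 * c) ^ 4"
proof (rule fps_cong_eqI)
  fix n
  have c: "c \<ge> 1" using assms by (cases c) auto
  have "fps_cong n (norm3 (euler_f c) * euler_f (9 * c))
    (norm3 (q_poch (fps_X ^ c) (3 * n)) * q_poch (fps_X ^ (9 * c)) n)"
    using c by (intro fps_cong_mult norm3_cong euler_f_cong_ge) auto
  also have "\<dots> = q_poch (fps_X ^ (3 * c)) (3 * n) * q_poch (fps_X ^ (3 * c)) n ^ 3"
    by (rule norm3_q_poch[OF assms])
  also have "fps_cong n \<dots> (euler_f (3 * c) * euler_f (3 * c) ^ 3)"
    using c by (intro fps_cong_mult fps_cong_power fps_cong_sym[OF euler_f_cong_ge]) auto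
  also have "euler_f (3 * c) * euler_f (3 * c) ^ 3 = euler_f (3 * c) ^ 4"
    by (simp flip: power_Suc)
  finally show "fps_cong n (norm3 (euler_f c) * euler_f (9 * c)) (euler_f (3 * c) ^ 4)" .
qed

lemma theta_nth_eq_0:
  assumes "3 dvd a" "3 dvd b" "\<bar>b\<bar> < a" "n mod 3 \<noteq> 0"
  shows "fps_nth (theta \<epsilon> a b) n = 0"
proof -
  have "nat (a * j ^ 2 + b * j) \<noteq> n" for j
  proof
    assume n: "nat (a * j ^ 2 + b * j) = n"
    have "int n = a * j ^ 2 + b * j" using theta_exponent_ge[OF assms(3), of j] n by linarith
    then have "3 dvd int n" using assms(1,2) by simp
    then show False using assms(4) by presburger
  qed
  then show ?thesis by (simp add: theta_def weighted_gf_def)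
qed

text \<open>By the 3-dissection only residues 0 and 1 occur, so the norm is a sum of two
  cubes.\<close>

lemma norm3_theta:
  "norm3 (theta (-1) 1 0 :: 'a::comm_ring_1 fps) = theta (-1) 9 0 ^ 3 - 8 * fps_X ^ 3 * theta (-1) 9 6 ^ 3"
proof -
  let ?B = "fps_X * (- 2 * theta (-1) 9 6) :: 'a fps"
  have "norm3 (theta (-1) 9 0 + ?B) = theta (-1) 9 0 ^ 3 + ?B ^ 3"
  proof (rule norm3_two_terms[where r = 1])
    fix n :: nat
    show "fps_nth (theta (-1) 9 0 :: 'a fps) n = 0" if "n mod 3 \<noteq> 0"
      using that by (intro theta_nth_eq_0) auto
    show "fps_nth ?B n = 0" if "n mod 3 \<noteq> 1"
    proof (cases n)
      case (Suc k)
      then have "k mod 3 \<noteq> 0" using that by presburger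
      then have "fps_nth (theta (-1) 9 6 :: 'a fps) k = 0" by (intro theta_nth_eq_0) auto
      then have "fps_nth (fps_const (- 2) * theta (-1) 9 6 :: 'a fps) k = 0" by simp
      then show ?thesis using Suc by (simp add: numeral_fps_const)
    qed simp
  qed simp
  then show ?thesis unfolding theta_dissection_3
    by (simp add: power_mult_distrib mult_ac)
qed

subsection \<open>Eta quotients\<close>

text \<open>Each \<open>g\<close> is the inverse of the corresponding \<open>f\<close>. Here p =
  \<open>theta (-1) 3 0\<close>, V = \<open>theta (-1) 3 2\<close>, Y = \<open>theta 1 3 2\<close>
  and Z = \<open>theta (-1) 6 4\<close>.\<close>

lemma dissection_2_algebra:
  fixes x f1 f2 f3 f4 f6 f12 g1 g2 g4 g6 g12 p Y Z W V :: "'a::idom"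
  assumes g: "f1 * g1 = 1" "f2 * g2 = 1" "f4 * g4 = 1" "f6 * g6 = 1" "f12 * g12 = 1"
    and p: "p * f6 = f3 ^ 2" and V: "V * f2 * f3 = f1 * f6 ^ 2" and Y: "Y * V * f12 = Z * f6 ^ 2"
    and Z: "Z * f4 * f6 = f2 * f12 ^ 2" and pY: "p * Y = f4 ^ 2 + x * Z ^ 2"
  shows "f3 ^ 3 * g1 = f4 ^ 3 * f6 ^ 2 * g2 ^ 2 * g12 + x * (f12 ^ 3 * g4)"
proof -
  have 1: "p = f3 ^ 2 * g6" using g p by algebra
  have 2: "Z = f2 * f12 ^ 2 * g4 * g6" using g Z by algebra
  have 3: "Y * f6 ^ 2 * f1 * f12 = Z * f6 ^ 2 * f2 * f3"  using V Y by algebra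
  have 4: "Y = Z * f2 * f3 * g1 * g12" using 3 g by algebra
  have 5: "f3 ^ 3 * g1 * (g6 * Z * f2 * g12) = f4 ^ 2 + x * Z ^ 2" using pY 1 4 by algebra
  have 6: "g6 * Z * f2 * g12 * (f4 * f6 ^ 2 * g2 ^ 2 * g12) = 1" using 2 g by algebra
  have 7: "Z ^ 2 * (f4 * f6 ^ 2 * g2 ^ 2 * g12) = f12 ^ 3 * g4" using 2 g by algebra
  show ?thesis using 5 6 7 by algebra
qed

text \<open>Here phi = phi(-q), p = \<open>theta (-1) 9 0\<close>, V =
  \<open>theta (-1) 9 6\<close>, and n1, n2 are the cubic norms of f_1 and f_2.\<close>

lemma dissection_3_algebra:
  fixes x f1 f2 f3 f6 f9 f18 g1 g2 g3 g6 g9 g18 p V phi n1 n2 :: "'a::idom"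
  assumes g: "f1 * g1 = 1" "f2 * g2 = 1" "f3 * g3 = 1" "f6 * g6 = 1" "f9 * g9 = 1" "f18 * g18 = 1"
    and p: "p * f18 = f9 ^ 2" and V: "V * f6 * f9 = f3 * f18 ^ 2" and phi: "phi * f2 = f1 ^ 2"
    and 3: "phi = p - 2 * x * V"
    and N: "(p ^ 3 - 8 * x ^ 3 * V ^ 3) * n2 = n1 ^ 2"  "n1 * f9 = f3 ^ 4" "n2 * f18 = f6 ^ 4"
  shows "f2 * g1 ^ 2 = f6 ^ 4 * f9 ^ 6 * g3 ^ 8 * g18 ^ 3 + 2 * x * (f6 ^ 3 * f9 ^ 3 * g3 ^ 7) + 4 * x ^ 2 * (f6 ^ 2 * f18 ^ 3 * g3 ^ 6)"
proof -
  have 1: "p = f9 ^ 2 * g18" using g p by algebra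
  have 2: "V = f3 * f18 ^ 2 * g6 * g9" using g V by algebra
  have 4: "n1 = f3 ^ 4 * g9" "n2 = f6 ^ 4 * g18" using N g by algebra+
  \<comment> \<open>The inverse of the norm p^3 - 8 x^3 V^3 = n1^2 / n2, written as an eta
    quotient.\<close>
  define M where "M = f9 ^ 2 * f6 ^ 4 * g3 ^ 8 * g18"
  have "(p ^ 3 - 8 * x ^ 3 * V ^ 3) * (f6 ^ 4 * g18) = (f3 ^ 4 * g9) ^ 2" using N(1) 4 by simp
  moreover have "(f3 ^ 4 * g9) ^ 2 * (f9 ^ 2 * g3 ^ 8) = 1" using g by algebra
  ultimately have 5: "(p ^ 3 - 8 * x ^ 3 * V ^ 3) * M = 1" unfolding M_def by algebra
  have 6: "phi * (f2 * g1 ^ 2) = 1" using phi g by algebra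
  have 7: "f2 * g1 ^ 2 = M * (p ^ 2 + 2 * x * p * V + 4 * x ^ 2 * V ^ 2)" using 3 5 6 by algebra
  have 8: "M * p ^ 2 = f6 ^ 4 * f9 ^ 6 * g3 ^ 8 * g18 ^ 3" unfolding M_def 1 by algebra
  have 9: "M * (p * V) = f6 ^ 3 * f9 ^ 3 * g3 ^ 7" unfolding M_def 1 2 using g by algebra
  have 10: "M * V ^ 2 = f6 ^ 2 * f18 ^ 3 * g3 ^ 6" unfolding M_def 2 using g by algebra
  show ?thesis unfolding 7 8[symmetric] 9[symmetric] 10[symmetric] by algebra
qed

lemma euler_f_inverse: "m \<ge> 1 \<Longrightarrow> euler_f m * inverse (euler_f m) = 1"
  by (rule inverse_mult_eq_1') (simp add: euler_f_has_prod(2))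

section \<open>Substitution of q^c for q, and the two dissections\<close>

lemma fps_cong_compose_X_power:
  fixes A B :: "'a::idom fps"
  assumes "fps_cong n A B" "c \<ge> 1"
  shows "fps_cong n (A oo fps_X ^ c) (B oo fps_X ^ c)"
proof -
  have "k div c < n" if "k < n" for k
    using that by (metis div_le_dividend le_less_trans)
  then show ?thesis using assms by (simp add: fps_cong_def fps_nth_compose_X_power)
qed

lemma euler_f_compose:
  assumes "m \<ge> 1" "c \<ge> 1"
  shows "euler_f m oo fps_X ^ c = euler_f (c * m)"
proof (rule fps_cong_eqI)
  fix n
  have c0: "fps_nth (fps_X ^ c :: rat fps) 0 = 0" using assms by simp
  have "fps_cong n (euler_f m oo fps_X ^ c) (q_poch (fps_X ^ m) n oo fps_X ^ c)"
    using assms by (intro fps_cong_compose_X_power euler_f_cong_ge) auto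
  also have "q_poch (fps_X ^ m) n oo fps_X ^ c = (q_poch (fps_X ^ (c * m)) n :: rat fps)"
    using c0 unfolding q_poch_def
    by (simp add: fps_compose_prod_distrib fps_compose_sub_distrib fps_compose_mult_distrib
        fps_compose_power[symmetric] power_mult)
  also have "fps_cong n \<dots> (euler_f (c * m))"
    using assms by (intro fps_cong_sym[OF euler_f_cong_ge]) auto
  finally show "fps_cong n (euler_f m oo fps_X ^ c) (euler_f (c * m))" .
qed

lemma inverse_euler_f_compose:
  assumes "m \<ge> 1" "c \<ge> 1"
  shows "inverse (euler_f m) oo fps_X ^ c = inverse (euler_f (c * m))"
  using assms by (subst fps_inverse_compose) (simp_all add: euler_f_has_prod(2) euler_f_compose)

text \<open>As rewrite rules these multiply all indices of an eta quotient by c, which exhibits the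
  parts of a dissection as series in q^c.\<close>

lemmas eta_compose = fps_compose_add_distrib fps_compose_mult_distrib fps_compose_power[symmetric]
  euler_f_compose inverse_euler_f_compose

lemma euler_f_dissection_2:
  "euler_f 3 ^ 3 * inverse (euler_f 1) =
   euler_f 4 ^ 3 * euler_f 6 ^ 2 * inverse (euler_f 2) ^ 2 * inverse (euler_f 12) +
   fps_X * (euler_f 12 ^ 3 * inverse (euler_f 4))"
proof (rule dissection_2_algebra)
  show "theta (-1) 3 0 * euler_f 6 = euler_f 3 ^ 2"
    using theta_minus_0[of 3] by simp
  show "theta (-1) 3 2 * euler_f 2 * euler_f 3 = euler_f 1 * euler_f 6 ^ 2"
    using theta_minus_3_2[of 1] by simp
  show "theta (-1) 6 4 * euler_f 4 * euler_f 6 = euler_f 2 * euler_f 12 ^ 2"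
    using theta_minus_3_2[of 2] by simp
  show "theta (-1) 3 0 * theta 1 3 2 = euler_f 4 ^ 2 + fps_X * theta (-1) 6 4 ^ 2"
    unfolding theta_product_dissection theta_minus_6_2 ..
qed (rule theta_plus_3_2 euler_f_inverse; simp)+

lemma euler_f_dissection_3:
  "euler_f 2 * inverse (euler_f 1) ^ 2 =
   euler_f 6 ^ 4 * euler_f 9 ^ 6 * inverse (euler_f 3) ^ 8 * inverse (euler_f 18) ^ 3 +
   2 * fps_X * (euler_f 6 ^ 3 * euler_f 9 ^ 3 * inverse (euler_f 3) ^ 7) +
   4 * fps_X ^ 2 * (euler_f 6 ^ 2 * euler_f 18 ^ 3 * inverse (euler_f 3) ^ 6)"
proof (rule dissection_3_algebra)
  show "theta (-1) 9 0 * euler_f 18 = euler_f 9 ^ 2"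
    using theta_minus_0[of 9] by simp
  show "theta (-1) 9 6 * euler_f 6 * euler_f 9 = euler_f 3 * euler_f 18 ^ 2"
    using theta_minus_3_2[of 3] by simp
  show phi: "theta (-1) 1 0 * euler_f 2 = euler_f 1 ^ 2"
    using theta_minus_0[of 1] by simp
  show "theta (-1) 1 0 = (theta (-1) 9 0 :: rat fps) - 2 * fps_X * theta (-1) 9 6"
    by (rule theta_dissection_3)
  \<comment> \<open>Multiplicativity reduces the norm of phi(-q) = f_1^2 / f_2 to the norms of Euler
    products.\<close>
  have "norm3 (theta (-1) 1 0) * norm3 (euler_f 2) = norm3 (euler_f 1) ^ 2"
    using arg_cong[OF phi, of norm3] by (simp only: norm3_mult power2_eq_square)
  then show "(theta (-1) 9 0 ^ 3 - 8 * fps_X ^ 3 * theta (-1) 9 6 ^ 3) * norm3 (euler_f 2) = norm3 (euler_f 1) ^ 2"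
    unfolding norm3_theta .
  show "norm3 (euler_f 1) * euler_f 9 = euler_f 3 ^ 4"
    using norm3_euler_f[of 1] by simp
  show "norm3 (euler_f 2) * euler_f 18 = euler_f 6 ^ 4"
    using norm3_euler_f[of 2] by simp
qed (rule euler_f_inverse; simp)+

section \<open>Extraction of the arithmetic progressions\<close>

lemma fps_nth_odd_part:
  fixes U V :: "'a::comm_ring_1 fps"
  assumes "F = (U oo fps_X ^ 2) + fps_X * (V oo fps_X ^ 2)"
  shows "fps_nth F (2 * n + 1) = fps_nth V n"
  by (simp add: assms fps_nth_compose_X_power)

lemma fps_nth_residue_3:
  fixes U V W :: "'a::comm_ring_1 fps"
  assumes "F = (U oo fps_X ^ 3) + fps_X * (V oo fps_X ^ 3) + fps_X ^ 2 * (W oo fps_X ^ 3)"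
  shows "fps_nth F (3 * n) = fps_nth U n" "fps_nth F (3 * n + 1) = fps_nth V n"
    "fps_nth F (3 * n + 2) = fps_nth W n"
proof -
  \<comment> \<open>At n = 0 truncated subtraction gives 0, which 3 divides; there the coefficient
    vanishes because of the factor q or q^2.\<close>
  have a: "\<not> 3 dvd 3 * n - 2" if "n > 0" using that by presburger
  have b: "\<not> 3 dvd 3 * n - 1" if "n > 0" using that by presburger
  have c: "\<not> 3 dvd 3 * n + 1" "\<not> 3 dvd 3 * n + 2" "\<not> 3 dvd Suc (3 * n)" "\<not> 3 dvd Suc (Suc (3 * n))" by presburger+
  show "fps_nth F (3 * n) = fps_nth U n" "fps_nth F (3 * n + 1) = fps_nth V n"
    "fps_nth F (3 * n + 2) = fps_nth W n"
    using a b c by (auto simp: assms fps_nth_compose_X_power fps_X_power_mult_nth)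
qed

text \<open>Both squares are even in q, so the odd part is twice the cross term, which collapses to
  a single eta quotient.\<close>

lemma square_dissection_2_algebra:
  fixes x f2 f3 f4 f6 f12 g1 g2 g4 g12 :: "'a::idom"
  assumes "f12 * g12 = 1" "f4 * g4 = 1"
    and "f3 ^ 3 * g1 = f4 ^ 3 * f6 ^ 2 * g2 ^ 2 * g12 + x * (f12 ^ 3 * g4)"
  shows "f3 ^ 6 * f6 ^ 6 * (g1 ^ 2 * g2 ^ 2) =
    ((f4 ^ 3 * f6 ^ 2 * g2 ^ 2 * g12) ^ 2 + x ^ 2 * (f12 ^ 3 * g4) ^ 2) * (f6 ^ 6 * g2 ^ 2) +
    x * (2 * (f4 ^ 2 * f6 ^ 8 * f12 ^ 2 * g2 ^ 4))"
proof -
  have "f3 ^ 6 * f6 ^ 6 * (g1 ^ 2 * g2 ^ 2) = (f3 ^ 3 * g1) ^ 2 * (f6 ^ 6 * g2 ^ 2)" by algebra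
  moreover have "f4 ^ 3 * f6 ^ 2 * g2 ^ 2 * g12 * (f12 ^ 3 * g4) * (f6 ^ 6 * g2 ^ 2) = f4 ^ 2 * f6 ^ 8 * f12 ^ 2 * g2 ^ 4"
    using assms(1,2) by algebra
  ultimately show ?thesis unfolding assms(3) by algebra
qed

lemma CP3_odd: "CP3 (2 * n + 1) = fps_nth (2 * (euler_f 2 ^ 2 * euler_f 3 ^ 8 * euler_f 6 ^ 2 * inverse (euler_f 1) ^ 4)) n"
proof -
  let ?g = "\<lambda>m. inverse (euler_f m)"
  \<comment> \<open>The even part and, below it, the odd part with q^2 replaced by q: all indices
    are halved.\<close>
  let ?U = "((euler_f 2 ^ 3 * euler_f 3 ^ 2 * ?g 1 ^ 2 * ?g 6) ^ 2 + fps_X * (euler_f 6 ^ 3 * ?g 2) ^ 2) * (euler_f 3 ^ 6 * ?g 1 ^ 2)"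
  let ?V = "2 * (euler_f 2 ^ 2 * euler_f 3 ^ 8 * euler_f 6 ^ 2 * ?g 1 ^ 4)"
  have "euler_f 3 ^ 6 * euler_f 6 ^ 6 / (euler_f 1 ^ 2 * euler_f 2 ^ 2) = euler_f 3 ^ 6 * euler_f 6 ^ 6 * (?g 1 ^ 2 * ?g 2 ^ 2)"
    by (simp add: fps_divide_unit fps_inverse_mult fps_inverse_power euler_f_has_prod(2))
  also have "\<dots> = ((euler_f 4 ^ 3 * euler_f 6 ^ 2 * ?g 2 ^ 2 * ?g 12) ^ 2 + fps_X ^ 2 * (euler_f 12 ^ 3 * ?g 4) ^ 2) * (euler_f 6 ^ 6 * ?g 2 ^ 2) +
    fps_X * (2 * (euler_f 4 ^ 2 * euler_f 6 ^ 8 * euler_f 12 ^ 2 * ?g 2 ^ 4))"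
    by (rule square_dissection_2_algebra[OF euler_f_inverse euler_f_inverse euler_f_dissection_2]) simp_all
  also have "\<dots> = (?U oo fps_X ^ 2) + fps_X * (?V oo fps_X ^ 2)"
    by (simp add: eta_compose mult_ac)
  finally show ?thesis unfolding CP3_def by (rule fps_nth_odd_part)
qed

text \<open>P, Q and R will be series in q^3, so in the square the terms x^3 QR and x^4 R^2 wrap
  around to the residues 0 and 1.\<close>

lemma square_dissection_3_algebra:
  fixes x f1 f2 f3 f6 g1 P Q R :: "'a::idom"
  assumes "f2 * g1 ^ 2 = P + 2 * x * Q + 4 * x ^ 2 * R"
  shows "2 * (f2 ^ 2 * f3 ^ 8 * f6 ^ 2 * g1 ^ 4) =
    2 * (f3 ^ 8 * f6 ^ 2 * (P ^ 2 + 16 * x ^ 3 * (Q * R)))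
    + x * (2 * (f3 ^ 8 * f6 ^ 2 * (4 * (P * Q) + 16 * x ^ 3 * R ^ 2)))
    + x ^ 2 * (2 * (f3 ^ 8 * f6 ^ 2 * (4 * Q ^ 2 + 8 * (P * R))))"
proof -
  have "2 * (f2 ^ 2 * f3 ^ 8 * f6 ^ 2 * g1 ^ 4) = 2 * (f3 ^ 8 * f6 ^ 2 * (f2 * g1 ^ 2) ^ 2)" by algebra
  then show ?thesis unfolding assms by algebra
qed

text \<open>In the last identity Q^2 and PR are the same eta quotient, so the coefficients combine
  to 2(4 + 8) = 24.\<close>

lemma CP3_parts_algebra:
  fixes x f1 f2 f3 f6 g1 g6 P Q R :: "'a::idom"
  assumes "f1 * g1 = 1" "f6 * g6 = 1"
    and P: "P = f2 ^ 4 * f3 ^ 6 * g1 ^ 8 * g6 ^ 3" and Q: "Q = f2 ^ 3 * f3 ^ 3 * g1 ^ 7" and R: "R = f2 ^ 2 * f6 ^ 3 * g1 ^ 6"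
  shows "2 * (f1 ^ 8 * f2 ^ 2 * (P ^ 2 + 16 * x * (Q * R))) =
      2 * (f2 ^ 10 * f3 ^ 12 * (g1 ^ 8 * g6 ^ 6)) + 32 * x * (f2 ^ 7 * f3 ^ 3 * f6 ^ 3 * g1 ^ 5)"
    "2 * (f1 ^ 8 * f2 ^ 2 * (4 * (P * Q) + 16 * x * R ^ 2)) =
      8 * (f2 ^ 9 * f3 ^ 9 * (g1 ^ 7 * g6 ^ 3)) + 32 * x * (f2 ^ 6 * f6 ^ 6 * g1 ^ 4)"
    "2 * (f1 ^ 8 * f2 ^ 2 * (4 * Q ^ 2 + 8 * (P * R))) = 24 * (f2 ^ 8 * f3 ^ 6 * g1 ^ 6)"
  unfolding P Q R using assms(1,2) by algebra+

text \<open>The first numerator has f_2^10, where the introductory formula prints f_2^6: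
  \<open>P ^ 2\<close> contributes f_2^8 and the prefactor f_2^2. With exponent 10 each eta quotient
  has total degree 8, as in the definition of \<open>CP3\<close>.\<close>

theorem theorem3p5:
  shows "Abs_fps (\<lambda>n. CP3 (6 * n + 1)) =
           2 * (euler_f 2 ^ 10 * euler_f 3 ^ 12 / (euler_f 1 ^ 8 * euler_f 6 ^ 6))
           + 32 * fps_X * (euler_f 2 ^ 7 * euler_f 3 ^ 3 * euler_f 6 ^ 3 / euler_f 1 ^ 5) \<and>
         Abs_fps (\<lambda>n. CP3 (6 * n + 3)) =
           8 * (euler_f 2 ^ 9 * euler_f 3 ^ 9 / (euler_f 1 ^ 7 * euler_f 6 ^ 3))
           + 32 * fps_X * (euler_f 2 ^ 6 * euler_f 6 ^ 6 / euler_f 1 ^ 4) \<and>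
         Abs_fps (\<lambda>n. CP3 (6 * n + 5)) =
           24 * (euler_f 2 ^ 8 * euler_f 3 ^ 6 / euler_f 1 ^ 6)"
proof -
  let ?g = "\<lambda>m. inverse (euler_f m)"
  \<comment> \<open>P, Q and R are the components of the 3-dissection of 1/phi(-q) with q^3 replaced
    by q: all indices are divided by 3.\<close>
  define P where "P = euler_f 2 ^ 4 * euler_f 3 ^ 6 * ?g 1 ^ 8 * ?g 6 ^ 3"
  define Q where "Q = euler_f 2 ^ 3 * euler_f 3 ^ 3 * ?g 1 ^ 7"
  define R where "R = euler_f 2 ^ 2 * euler_f 6 ^ 3 * ?g 1 ^ 6"
  let ?U = "2 * (euler_f 1 ^ 8 * euler_f 2 ^ 2 * (P ^ 2 + 16 * fps_X * (Q * R)))"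
  let ?V = "2 * (euler_f 1 ^ 8 * euler_f 2 ^ 2 * (4 * (P * Q) + 16 * fps_X * R ^ 2))"
  let ?W = "2 * (euler_f 1 ^ 8 * euler_f 2 ^ 2 * (4 * Q ^ 2 + 8 * (P * R)))"
  let ?F = "2 * (euler_f 2 ^ 2 * euler_f 3 ^ 8 * euler_f 6 ^ 2 * ?g 1 ^ 4)"
  let ?c = "\<lambda>A. A oo fps_X ^ 3 :: rat fps"
  have c: "?c P = euler_f 6 ^ 4 * euler_f 9 ^ 6 * ?g 3 ^ 8 * ?g 18 ^ 3"
    "?c Q = euler_f 6 ^ 3 * euler_f 9 ^ 3 * ?g 3 ^ 7" "?c R = euler_f 6 ^ 2 * euler_f 18 ^ 3 * ?g 3 ^ 6"
    by (simp_all add: P_def Q_def R_def eta_compose)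
  have "?F = 2 * (euler_f 3 ^ 8 * euler_f 6 ^ 2 * (?c P ^ 2 + 16 * fps_X ^ 3 * (?c Q * ?c R)))
    + fps_X * (2 * (euler_f 3 ^ 8 * euler_f 6 ^ 2 * (4 * (?c P * ?c Q) + 16 * fps_X ^ 3 * ?c R ^ 2)))
    + fps_X ^ 2 * (2 * (euler_f 3 ^ 8 * euler_f 6 ^ 2 * (4 * ?c Q ^ 2 + 8 * (?c P * ?c R))))"
    unfolding c by (rule square_dissection_3_algebra[OF euler_f_dissection_3])
  also have "\<dots> = ?c ?U + fps_X * ?c ?V + fps_X ^ 2 * ?c ?W"
    by (simp add: eta_compose)
  finally have F: "?F = ?c ?U + fps_X * ?c ?V + fps_X ^ 2 * ?c ?W" .
  have CP: "CP3 (6 * n + 1) = fps_nth ?U n" "CP3 (6 * n + 3) = fps_nth ?V n" "CP3 (6 * n + 5) = fps_nth ?W n" for n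
  proof -
    have "6 * n + 1 = 2 * (3 * n) + 1" "6 * n + 3 = 2 * (3 * n + 1) + 1" "6 * n + 5 = 2 * (3 * n + 2) + 1"
      by simp_all
    then show "CP3 (6 * n + 1) = fps_nth ?U n" "CP3 (6 * n + 3) = fps_nth ?V n" "CP3 (6 * n + 5) = fps_nth ?W n"
      by (simp_all only: CP3_odd fps_nth_residue_3[OF F])
  qed
  \<comment> \<open>\<open>fps_nth_inverse\<close> says that \<open>Abs_fps\<close> undoes
    \<open>fps_nth\<close>; it does not concern multiplicative inverses.\<close>
  have "Abs_fps (\<lambda>n. CP3 (6 * n + 1)) = ?U" "Abs_fps (\<lambda>n. CP3 (6 * n + 3)) = ?V" "Abs_fps (\<lambda>n. CP3 (6 * n + 5)) = ?W"
    unfolding CP by (simp_all only: fps_nth_inverse)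
  moreover have "euler_f 1 * ?g 1 = 1" "euler_f 6 * ?g 6 = 1" by (rule euler_f_inverse; simp)+
  note CP3_parts_algebra[OF this P_def Q_def R_def]
  ultimately show ?thesis
    by (simp add: fps_divide_unit fps_inverse_mult fps_inverse_power euler_f_has_prod(2))
qed

end
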